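(* Let $s\in(0,1]$ and $p\in[1,+\infty)$ be such that $sp=N$ and $s\neq p$. Let $\Omega\subset\mathbb{R}^N$ be an open and bounded domain with Lipschitz boundary. Let $\widetilde s\in[0,1]$ and $\widetilde p\in[1,+\infty]$. If $\widetilde s$ and $\widetilde p$ do not satisfy $$\text{either}\quad\begin{cases}0<\widetilde s<s,\\ 1\le\widetilde p<\dfrac{N}{\widetilde s},\end{cases}\qquad\text{or}\qquad\begin{cases}\widetilde s=0,\\ 1\le\widetilde p<+\infty,\end{cases}$$ then the space $W^{s,p}(\Omega)$ is not compactly embedded in $W^{\widetilde s,\widetilde p}(\Omega)$.
   Context: $N\ge1$ is an integer and functions are real-valued and measurable. For $s\in[0,1]$ and $p\in[1,+\infty)$ define $[u]_{W^{0,p}(\Omega)}:=\|u\|_{L^p(\Omega)}$, $[u]_{W^{1,p}(\Omega)}:=\|\nabla u\|_{L^p(\Omega)}$ (weak gradient) and, for $s\in(0,1)$, $$[u]_{W^{s,p}(\Omega)}:=\left(c_{N,s,p}\iint_{\Omega\times\Omega}\frac{|u(x)-u(y)|^p}{|x-y|^{N+sp}}\,dx\,dy\right)^{1/p},\qquad c_{N,s,p}:=\frac{s\,2^{2s-1}\,\Gamma\left(\frac{ps+p+N-2}{2}\right)}{\pi^{N/2}\,\Gamma(1-s)}.$$ Set $W^{s,p}(\Omega):=\{u\in L^p(\Omega):[u]_{W^{s,p}(\Omega)}<+\infty\}$, with norm $\|u\|_{W^{0,p}(\Omega)}:=\|u\|_{L^p(\Omega)}$ if $s=0$ and $\|u\|_{W^{s,p}(\Omega)}:=\big([u]^p_{W^{s,p}(\Omega)}+\|u\|^p_{L^p(\Omega)}\big)^{1/p}$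 if $s\in(0,1]$. For $p=+\infty$: $W^{0,\infty}(\Omega):=L^\infty(\Omega)$ and, for $s\in(0,1]$, $W^{s,\infty}(\Omega):=C^{0,s}(\Omega)$ with norm $\|u\|_{L^\infty(\Omega)}+\sup_{x\neq y\in\Omega}\frac{|u(x)-u(y)|}{|x-y|^s}$ (functions being identified up to a.e. equality). *)

theory Defs
  imports "HOL-Analysis.Analysis" "HOL-Probability.Essential_Supremum"
begin

text \<open>
  Function spaces are sets of Lebesgue measurable functions on the whole space of which only the
  restriction to \<open>\<Omega>\<close> matters. Norms and seminorms are extended functionals with values in
  \<^typ>\<open>ennreal\<close>; they do not distinguish functions that agree almost everywhere on \<open>\<Omega>\<close>.
\<close>

definition lipschitz_boundary :: "'a::euclidean_space set \<Rightarrow> bool" where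
  "lipschitz_boundary \<Omega> \<longleftrightarrow>
     (\<forall>z\<in>frontier \<Omega>. \<exists>U e L \<gamma>.
        open U \<and> z \<in> U \<and> norm e = 1 \<and> L-lipschitz_on {y. y \<bullet> e = 0} (\<gamma> :: 'a \<Rightarrow> real) \<and>
        \<Omega> \<inter> U = {x \<in> U. \<gamma> (x - (x \<bullet> e) *\<^sub>R e) < x \<bullet> e})"

text \<open>Real powers of extended numbers, intended for positive exponents.\<close>

definition enn_powr :: "ennreal \<Rightarrow> real \<Rightarrow> ennreal" where
  "enn_powr a r = (if a = \<infinity> then \<infinity> else ennreal (enn2real a powr r))"

definition Lp_norm :: "'a::euclidean_space set \<Rightarrow> real \<Rightarrow> ('a \<Rightarrow> 'b::real_normed_vector) \<Rightarrow> ennreal" where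
  "Lp_norm \<Omega> p u = enn_powr (\<integral>\<^sup>+x. ennreal (norm (u x) powr p) \<partial>lebesgue_on \<Omega>) (1 / p)"

definition Linf_norm :: "'a::euclidean_space set \<Rightarrow> ('a \<Rightarrow> real) \<Rightarrow> ennreal" where
  "Linf_norm \<Omega> u = esssup (lebesgue_on \<Omega>) (\<lambda>x. ennreal \<bar>u x\<bar>)"

primrec Ck :: "nat \<Rightarrow> ('a::euclidean_space \<Rightarrow> real) \<Rightarrow> bool" where
  "Ck 0 f \<longleftrightarrow> continuous_on UNIV f"
| "Ck (Suc k) f \<longleftrightarrow>
     (\<forall>x. f differentiable (at x)) \<and> (\<forall>b\<in>Basis. Ck k (\<lambda>x. frechet_derivative f (at x) b))"

definition test_function :: "'a::euclidean_space set \<Rightarrow> ('a \<Rightarrow> real) \<Rightarrow> bool" where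
  "test_function \<Omega> \<phi> \<longleftrightarrow>
     (\<forall>k. Ck k \<phi>) \<and> (\<exists>K. compact K \<and> K \<subseteq> \<Omega> \<and> (\<forall>x. x \<notin> K \<longrightarrow> \<phi> x = 0))"

definition locally_integrable ::
    "'a::euclidean_space set \<Rightarrow> ('a \<Rightarrow> 'b::euclidean_space) \<Rightarrow> bool" where
  "locally_integrable \<Omega> u \<longleftrightarrow> (\<forall>K. compact K \<and> K \<subseteq> \<Omega> \<longrightarrow> set_integrable lebesgue K u)"

definition has_weak_gradient ::
    "'a::euclidean_space set \<Rightarrow> ('a \<Rightarrow> real) \<Rightarrow> ('a \<Rightarrow> 'a) \<Rightarrow> bool" where
  "has_weak_gradient \<Omega> u v \<longleftrightarrow>
     locally_integrable \<Omega> u \<and> locally_integrable \<Omega> v \<and>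
     (\<forall>\<phi>. test_function \<Omega> \<phi> \<longrightarrow> (\<forall>b\<in>Basis.
        (LINT x|lebesgue_on \<Omega>. u x * frechet_derivative \<phi> (at x) b) =
        - (LINT x|lebesgue_on \<Omega>. (v x \<bullet> b) * \<phi> x)))"

definition gagliardo_const :: "nat \<Rightarrow> real \<Rightarrow> real \<Rightarrow> real" where
  "gagliardo_const N s p =
     s * 2 powr (2 * s - 1) * Gamma ((p * s + p + real N - 2) / 2) /
     (pi powr (real N / 2) * Gamma (1 - s))"

text \<open>
  For \<open>s = 1\<close>: the weak gradient of \<open>u\<close> is unique up to null sets when it exists, so the infimum is
  then the norm of that gradient. If there is no weak gradient, the infimum is \<open>\<infinity>\<close>.
  For \<open>0 < s < 1\<close>: the integrand vanishes on the diagonal, since \<open>0 / 0 = 0\<close>.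
\<close>

definition sobolev_seminorm ::
    "'a::euclidean_space set \<Rightarrow> real \<Rightarrow> real \<Rightarrow> ('a \<Rightarrow> real) \<Rightarrow> ennreal" where
  "sobolev_seminorm \<Omega> s p u =
     (if s = 0 then Lp_norm \<Omega> p u
      else if s = 1 then (INF v\<in>{v. has_weak_gradient \<Omega> u v}. Lp_norm \<Omega> p v)
      else enn_powr
        (ennreal (gagliardo_const DIM('a) s p) *
         (\<integral>\<^sup>+x. (\<integral>\<^sup>+y. ennreal (\<bar>u x - u y\<bar> powr p / norm (x - y) powr (real DIM('a) + s * p))
            \<partial>lebesgue_on \<Omega>) \<partial>lebesgue_on \<Omega>))
        (1 / p))"

definition hoelder_seminorm ::
    "'a::euclidean_space set \<Rightarrow> real \<Rightarrow> ('a \<Rightarrow> real) \<Rightarrow> ennreal" where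
  "hoelder_seminorm \<Omega> s w =
     (SUP (x, y)\<in>{(x, y). x \<in> \<Omega> \<and> y \<in> \<Omega> \<and> x \<noteq> y}.
        ennreal (\<bar>w x - w y\<bar> / norm (x - y) powr s))"

text \<open>
  For \<open>p = \<infinity>\<close> and \<open>s > 0\<close> the space consists of the functions that agree almost everywhere
  with an element \<open>w\<close> of \<open>C\<^sup>0\<^sup>,\<^sup>s(\<Omega>)\<close>. On an open \<open>\<Omega>\<close> such a \<open>w\<close> is unique on \<open>\<Omega>\<close>, so the infimum
  in the norm is the seminorm of this representative.
\<close>

definition sobolev_norm ::
    "'a::euclidean_space set \<Rightarrow> real \<Rightarrow> ereal \<Rightarrow> ('a \<Rightarrow> real) \<Rightarrow> ennreal" where
  "sobolev_norm \<Omega> s p u =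
     (if p = \<infinity> then
        (if s = 0 then Linf_norm \<Omega> u
         else Linf_norm \<Omega> u +
           (INF w\<in>{w. AE x in lebesgue_on \<Omega>. w x = u x}. hoelder_seminorm \<Omega> s w))
      else
        (let q = real_of_ereal p in
         if s = 0 then Lp_norm \<Omega> q u
         else enn_powr (enn_powr (sobolev_seminorm \<Omega> s q u) q + enn_powr (Lp_norm \<Omega> q u) q)
                (1 / q)))"

definition sobolev_space ::
    "'a::euclidean_space set \<Rightarrow> real \<Rightarrow> ereal \<Rightarrow> ('a \<Rightarrow> real) set" where
  "sobolev_space \<Omega> s p =
     (if p = \<infinity> then
        (if s = 0 then {u \<in> borel_measurable (lebesgue_on \<Omega>). Linf_norm \<Omega> u < \<infinity>}
         else {u \<in> borel_measurable (lebesgue_on \<Omega>). Linf_norm \<Omega> u < \<infinity> \<and>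
                (\<exists>w. (AE x in lebesgue_on \<Omega>. w x = u x) \<and> hoelder_seminorm \<Omega> s w < \<infinity>)})
      else
        {u \<in> borel_measurable (lebesgue_on \<Omega>).
           Lp_norm \<Omega> (real_of_ereal p) u < \<infinity> \<and> sobolev_seminorm \<Omega> s (real_of_ereal p) u < \<infinity>})"

definition compactly_embedded ::
    "('a \<Rightarrow> real) set \<Rightarrow> (('a \<Rightarrow> real) \<Rightarrow> ennreal) \<Rightarrow>
     ('a \<Rightarrow> real) set \<Rightarrow> (('a \<Rightarrow> real) \<Rightarrow> ennreal) \<Rightarrow> bool" where
  "compactly_embedded X nX Y nY \<longleftrightarrow>
     X \<subseteq> Y \<and>
     (\<exists>C::real. \<forall>u\<in>X. nY u \<le> ennreal C * nX u) \<and>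
     (\<forall>f :: nat \<Rightarrow> 'a \<Rightarrow> real. (\<forall>n. f n \<in> X) \<and> (\<exists>B::real. \<forall>n. nX (f n) \<le> ennreal B) \<longrightarrow>
        (\<exists>u\<in>Y. \<exists>r :: nat \<Rightarrow> nat. strict_mono r \<and>
           (\<lambda>n. nY (\<lambda>x. f (r n) x - u x)) \<longlonglongrightarrow> 0))"

end

theory Submission
  imports Defs
begin

text \<open>
  Two families of functions on \<open>\<real>\<^sup>N\<close> refute compactness. Since \<open>s p = N\<close>, the concentrating bumps
  \<open>\<lambda>x. \<phi>(l (x - x\<^sub>0))\<close> stay bounded in \<open>W\<^sup>s\<^sup>,\<^sup>p\<close> as \<open>l \<rightarrow> \<infinity>\<close>. They tend to \<open>0\<close> almost everywhere, but
  their sup norm is constant, and the \<open>q\<close>-th power of their seminorm in \<open>W\<^sup>t\<^sup>,\<^sup>q\<close> is of order \<open>l\<^sup>t\<^sup>q\<^sup>-\<^sup>N\<close>;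
  this settles \<open>q = \<infinity>\<close> and \<open>t q \<ge> N\<close> with \<open>0 < t < s\<close>. The oscillating functions
  \<open>\<lambda>x. l\<^sup>-\<^sup>s sin (l (x \<bullet> e))\<close> are bounded in \<open>W\<^sup>s\<^sup>,\<^sup>p\<close> and tend to \<open>0\<close> uniformly, but their seminorm in
  \<open>W\<^sup>t\<^sup>,\<^sup>q\<close> is bounded below for \<open>t \<ge> s\<close> and every finite \<open>q\<close>. In each case a limit in the target space
  would have to vanish almost everywhere.
\<close>

subsection \<open>Norms and a criterion for non-compactness\<close>

text \<open>Write N for the dimension. With \<open>s * p = N\<close> the Gagliardo kernel is |x -
  y|^(-2 N). The increments of both families are at most an amplitude times the minimum of 2 and a
  multiple of l |x - y|, so a single kernel estimate of size l^N serves both: for bumps the volume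
  l^(-N) of the support compensates it, for oscillations the amplitude power l^(-s p). Near the
  diagonal that estimate converges because p > N, which amounts to s < 1. Order one is therefore
  treated separately, through explicit classical gradients. The limit is identified only up to null
  sets, so each lower bound must hold for every function that agrees almost everywhere with a member
  of the family. In a double integral this is harmless. At order one the seminorm is an infimum over
  all weak gradients, and these are accessible only through testing; a bound independent of the
  gradient requires a smooth test function supported in \<Omega> and tuned to the oscillation. This
  is what the flat exponentials are for.\<close>

lemma nn_integral_lebesgue_on:
  fixes S :: "'a::euclidean_space set"
  assumes "S \<in> sets lebesgue"
  shows "(\<integral>\<^sup>+x. f x \<partial>lebesgue_on S) = (\<integral>\<^sup>+x. f x * indicator S x \<partial>lborel)"
  using assms by (subst nn_integral_restrict_space) (auto simp: nn_integral_completion)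

section \<open>Powers of extended nonnegative reals and elementary norm comparisons\<close>

lemma enn_powr_ennreal: "0 \<le> x \<Longrightarrow> enn_powr (ennreal x) r = ennreal (x powr r)"
  by (simp add: enn_powr_def)

lemma enn_powr_mono:
  assumes "a \<le> b" "0 \<le> r"
  shows "enn_powr a r \<le> enn_powr b r"
proof (cases "b = \<infinity>")
  case False
  then show ?thesis using assms
    by (cases a; cases b) (auto simp: enn_powr_def top_unique intro!: powr_mono2 ennreal_leI)
qed (simp add: enn_powr_def)

lemma enn_powr_powr: "enn_powr (enn_powr a r) t = enn_powr a (r * t)"
  by (simp add: enn_powr_def powr_powr)

lemma enn_powr_1: "enn_powr a 1 = a"
  by (cases a) (auto simp: enn_powr_def)

lemma enn_powr_inverse: "0 < r \<Longrightarrow> enn_powr (enn_powr a r) (1 / r) = a"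
  by (simp add: enn_powr_powr enn_powr_1)

lemma enn_powr_inverse': "0 < r \<Longrightarrow> enn_powr (enn_powr a (1 / r)) r = a"
  by (simp add: enn_powr_powr enn_powr_1)

lemma enn_powr_pos: "0 < a \<Longrightarrow> 0 < enn_powr a r"
  by (cases a) (auto simp: enn_powr_def)

text \<open>The inverse power turns a bound on \<open>enn_powr (a n) r\<close> into one on
  \<open>a n\<close>, so monotonicity replaces a continuity argument at \<infinity>.\<close>

lemma tendsto_0_enn_powr:
  assumes "(\<lambda>n. a n) \<longlonglongrightarrow> (0::ennreal)" "0 < r"
  shows "(\<lambda>n. enn_powr (a n) r) \<longlonglongrightarrow> 0"
proof (rule order_tendstoI)
  fix e :: ennreal assume e: "0 < e"
  have "0 < enn_powr e (1 / r)" using e by (rule enn_powr_pos)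
  then have "\<forall>\<^sub>F n in sequentially. a n < enn_powr e (1 / r)"
    using assms(1) by (simp add: order_tendsto_iff)
  then show "\<forall>\<^sub>F n in sequentially. enn_powr (a n) r < e"
  proof eventually_elim
    case (elim n)
    show ?case
    proof (rule ccontr)
      assume "\<not> enn_powr (a n) r < e"
      then have "enn_powr e (1 / r) \<le> enn_powr (enn_powr (a n) r) (1 / r)"
        using assms by (intro enn_powr_mono) auto
      then show False using elim assms by (simp add: enn_powr_inverse)
    qed
  qed
qed simp

lemma Lp_norm_le_sobolev_norm:
  assumes "0 < q"
  shows "Lp_norm \<Omega> q u \<le> sobolev_norm \<Omega> s (ereal q) u"
proof (cases "s = 0")
  case False
  have "Lp_norm \<Omega> q u = enn_powr (enn_powr (Lp_norm \<Omega> q u) q) (1 / q)"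
    using assms by (simp add: enn_powr_inverse)
  also have "\<dots> \<le> enn_powr (enn_powr (sobolev_seminorm \<Omega> s q u) q + enn_powr (Lp_norm \<Omega> q u) q) (1 / q)"
    using assms by (intro enn_powr_mono) auto
  finally show ?thesis using False by (simp add: sobolev_norm_def Let_def)
qed (simp add: sobolev_norm_def)

lemma sobolev_seminorm_le_norm:
  assumes "0 < q" "s \<noteq> 0"
  shows "sobolev_seminorm \<Omega> s q u \<le> sobolev_norm \<Omega> s (ereal q) u"
proof -
  have "sobolev_seminorm \<Omega> s q u = enn_powr (enn_powr (sobolev_seminorm \<Omega> s q u) q) (1 / q)"
    using assms by (simp add: enn_powr_inverse)
  also have "\<dots> \<le> enn_powr (enn_powr (sobolev_seminorm \<Omega> s q u) q + enn_powr (Lp_norm \<Omega> q u) q) (1 / q)"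
    using assms by (intro enn_powr_mono) auto
  finally show ?thesis using assms by (simp add: sobolev_norm_def Let_def)
qed

lemma sobolev_norm_le:
  assumes "0 < q" "s \<noteq> 0" "0 \<le> A" "0 \<le> B"
    and "Lp_norm \<Omega> q u \<le> ennreal A" "sobolev_seminorm \<Omega> s q u \<le> ennreal B"
  shows "sobolev_norm \<Omega> s (ereal q) u \<le> ennreal ((B powr q + A powr q) powr (1 / q))"
proof -
  have "enn_powr (sobolev_seminorm \<Omega> s q u) q + enn_powr (Lp_norm \<Omega> q u) q
      \<le> enn_powr (ennreal B) q + enn_powr (ennreal A) q"
    using assms by (intro add_mono enn_powr_mono) auto
  also have "\<dots> = ennreal (B powr q + A powr q)"
    using assms by (simp add: enn_powr_ennreal)
  finally have "enn_powr (enn_powr (sobolev_seminorm \<Omega> s q u) q + enn_powr (Lp_norm \<Omega> q u) q) (1 / q)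
      \<le> enn_powr (ennreal (B powr q + A powr q)) (1 / q)"
    using assms by (intro enn_powr_mono) auto
  then show ?thesis using assms by (simp add: sobolev_norm_def Let_def enn_powr_ennreal del: ennreal_plus)
qed

text \<open>Fatou's lemma: the integral of |u|^q is at most the lower limit of the integrals of |g n
  - u|^q, which is 0. No domination of the \<open>g n\<close> enters.\<close>

lemma Lp_limit_AE_0:
  fixes \<Omega> :: "'a::euclidean_space set"
  assumes "0 < q"
    and [measurable]: "\<And>n. g n \<in> borel_measurable (lebesgue_on \<Omega>)" "u \<in> borel_measurable (lebesgue_on \<Omega>)"
    and "AE x in lebesgue_on \<Omega>. (\<lambda>n. g n x) \<longlonglongrightarrow> (0::real)"
    and lim: "(\<lambda>n. Lp_norm \<Omega> q (\<lambda>x. g n x - u x)) \<longlonglongrightarrow> 0"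
  shows "AE x in lebesgue_on \<Omega>. u x = 0"
proof -
  let ?I = "\<lambda>n. \<integral>\<^sup>+x. ennreal (norm (g n x - u x) powr q) \<partial>lebesgue_on \<Omega>"
  have "(\<lambda>n. enn_powr (Lp_norm \<Omega> q (\<lambda>x. g n x - u x)) q) \<longlonglongrightarrow> 0"
    using lim assms(1) by (rule tendsto_0_enn_powr)
  then have I0: "?I \<longlonglongrightarrow> 0"
    using assms(1) by (simp add: Lp_norm_def enn_powr_inverse')
  have "(\<integral>\<^sup>+x. ennreal (norm (u x) powr q) \<partial>lebesgue_on \<Omega>)
      \<le> (\<integral>\<^sup>+x. liminf (\<lambda>n. ennreal (norm (g n x - u x) powr q)) \<partial>lebesgue_on \<Omega>)"
  proof (rule nn_integral_mono_AE)
    show "AE x in lebesgue_on \<Omega>. ennreal (norm (u x) powr q)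
        \<le> liminf (\<lambda>n. ennreal (norm (g n x - u x) powr q))"
      using assms(4)
    proof eventually_elim
      case (elim x)
      have "(\<lambda>n. ennreal (norm (g n x - u x) powr q)) \<longlonglongrightarrow> ennreal (norm (0 - u x) powr q)"
        using assms(1)
        by (intro tendsto_ennrealI tendsto_powr2 tendsto_norm tendsto_diff elim tendsto_const) auto
      from lim_imp_Liminf[OF _ this] show ?case by simp
    qed
  qed
  also have "\<dots> \<le> liminf ?I" by (rule nn_integral_liminf) measurable
  also have "\<dots> = 0" using lim_imp_Liminf[OF _ I0] by simp
  finally have "(\<integral>\<^sup>+x. ennreal (norm (u x) powr q) \<partial>lebesgue_on \<Omega>) = 0" by simp
  then have "AE x in lebesgue_on \<Omega>. ennreal (norm (u x) powr q) = 0"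
    by (subst (asm) nn_integral_0_iff_AE) auto
  then show ?thesis by eventually_elim simp
qed

text \<open>The bound \<open>low\<close> concerns all \<open>w\<close> that agree almost everywhere
  with \<open>f n\<close> because it is applied to \<open>f (r n) - u\<close>, where
  \<open>u\<close> is known to vanish only almost everywhere. The seminorms of these differences
  then stay above \<open>c\<close> although their norms tend to 0.\<close>

lemma not_compactly_embedded_seminorm:
  fixes \<Omega> :: "'a::euclidean_space set"
  assumes "0 < q" "t \<noteq> 0" "0 < c"
    and fX: "\<And>n. f n \<in> X" "\<And>n. nX (f n) \<le> ennreal B"
    and meas: "\<And>n. f n \<in> borel_measurable (lebesgue_on \<Omega>)"
    and lim: "AE x in lebesgue_on \<Omega>. (\<lambda>n. f n x) \<longlonglongrightarrow> 0"
    and low: "\<And>n w. w \<in> borel_measurable (lebesgue_on \<Omega>) \<Longrightarrow> AE x in lebesgue_on \<Omega>. w x = f n x \<Longrightarrow> c \<le> sobolev_seminorm \<Omega> t q w"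
  shows "\<not> compactly_embedded X nX (sobolev_space \<Omega> t (ereal q)) (sobolev_norm \<Omega> t (ereal q))"
proof
  assume "compactly_embedded X nX (sobolev_space \<Omega> t (ereal q)) (sobolev_norm \<Omega> t (ereal q))"
  then obtain u r where u: "u \<in> sobolev_space \<Omega> t (ereal q)" and r: "strict_mono r"
    and L: "(\<lambda>n. sobolev_norm \<Omega> t (ereal q) (\<lambda>x. f (r n) x - u x)) \<longlonglongrightarrow> 0"
    unfolding compactly_embedded_def using fX by metis
  have u_meas: "u \<in> borel_measurable (lebesgue_on \<Omega>)" using u by (auto simp: sobolev_space_def)
  have "AE x in lebesgue_on \<Omega>. u x = 0"
  proof (rule Lp_limit_AE_0[where g = "\<lambda>n. f (r n)" and q = q])
    show "AE x in lebesgue_on \<Omega>. (\<lambda>n. f (r n) x) \<longlonglongrightarrow> 0"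
      using lim by eventually_elim (use r in \<open>auto dest: LIMSEQ_subseq_LIMSEQ simp: o_def\<close>)
    show "(\<lambda>n. Lp_norm \<Omega> q (\<lambda>x. f (r n) x - u x)) \<longlonglongrightarrow> 0"
      by (rule tendsto_sandwich[OF _ _ tendsto_const L])
         (auto intro!: always_eventually Lp_norm_le_sobolev_norm \<open>0 < q\<close>)
  qed (use meas u_meas \<open>0 < q\<close> in auto)
  then have "\<And>n. c \<le> sobolev_seminorm \<Omega> t q (\<lambda>x. f (r n) x - u x)"
    using meas u_meas by (intro low borel_measurable_diff) (auto elim: eventually_mono)
  then have "\<And>n. c \<le> sobolev_norm \<Omega> t (ereal q) (\<lambda>x. f (r n) x - u x)"
    using sobolev_seminorm_le_norm[OF \<open>0 < q\<close> \<open>t \<noteq> 0\<close>] order_trans by metis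
  then have "c \<le> 0" using LIMSEQ_le_const[OF L, of c] by blast
  then show False using \<open>0 < c\<close> by simp
qed

lemma Linf_norm_AE: "AE x in lebesgue_on \<Omega>. ennreal \<bar>u x\<bar> \<le> Linf_norm \<Omega> u"
  unfolding Linf_norm_def by (rule esssup_AE)

lemma AE_lebesgue_on_open_witness:
  fixes \<Omega> :: "'a::euclidean_space set"
  assumes "open \<Omega>" "x0 \<in> \<Omega>" "0 < d" "AE x in lebesgue_on \<Omega>. P x"
  shows "\<exists>x. x \<in> \<Omega> \<and> dist x0 x < d \<and> P x"
proof (rule ccontr)
  assume *: "\<not> ?thesis"
  have "AE x in lebesgue. x \<in> \<Omega> \<longrightarrow> P x"
    using assms(1,4) by (subst (asm) AE_restrict_space_iff) auto
  then have "AE x in lebesgue. x \<notin> \<Omega> \<inter> ball x0 d"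
    by eventually_elim (use * in auto)
  then have "\<Omega> \<inter> ball x0 d \<in> null_sets lebesgue"
    using assms(1) by (subst AE_iff_null_sets) auto
  then have "negligible (\<Omega> \<inter> ball x0 d)" by (simp add: negligible_iff_null_sets)
  then have "\<Omega> \<inter> ball x0 d = {}"
    using open_not_negligible[of "\<Omega> \<inter> ball x0 d"] assms(1) by auto
  then show False using assms(2,3) by auto
qed

text \<open>For every \<open>t\<close> the norm dominates the essential supremum, so one argument
  covers L^\<infinity> and all Hoelder spaces. Once the limit vanishes almost everywhere, some
  \<open>f (r n)\<close> is below 1/2 almost everywhere, yet by continuity it exceeds 1/2 near
  \<open>x0\<close>, on a set of positive measure.\<close>

lemma not_compactly_embedded_Linf:
  fixes \<Omega> :: "'a::euclidean_space set"
  assumes "open \<Omega>" "x0 \<in> \<Omega>"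
    and fX: "\<And>n. f n \<in> X" "\<And>n. nX (f n) \<le> ennreal B"
    and cont: "\<And>n. isCont (f n) x0" and f1: "\<And>n. f n x0 = 1"
    and lim: "AE x in lebesgue_on \<Omega>. (\<lambda>n. f n x) \<longlonglongrightarrow> 0"
  shows "\<not> compactly_embedded X nX (sobolev_space \<Omega> t \<infinity>) (sobolev_norm \<Omega> t \<infinity>)"
proof
  assume "compactly_embedded X nX (sobolev_space \<Omega> t \<infinity>) (sobolev_norm \<Omega> t \<infinity>)"
  then obtain u r where r: "strict_mono r"
    and L: "(\<lambda>n. sobolev_norm \<Omega> t \<infinity> (\<lambda>x. f (r n) x - u x)) \<longlonglongrightarrow> 0"
    unfolding compactly_embedded_def using fX by metis
  let ?e = "\<lambda>n. Linf_norm \<Omega> (\<lambda>x. f (r n) x - u x)"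
  have e0: "?e \<longlonglongrightarrow> 0"
    by (rule tendsto_sandwich[OF _ _ tendsto_const L])
       (auto intro!: always_eventually simp: sobolev_norm_def)
  \<comment> \<open>One null set for all \<open>n\<close>, so that the limit can be taken pointwise
    outside it.\<close>
  have AEall: "AE x in lebesgue_on \<Omega>. \<forall>n. ennreal \<bar>f (r n) x - u x\<bar> \<le> ?e n"
    by (subst AE_all_countable) (auto intro: Linf_norm_AE)
  have u0: "AE x in lebesgue_on \<Omega>. u x = 0" using AEall lim
  proof eventually_elim
    case (elim x)
    have "(\<lambda>n. ennreal \<bar>f (r n) x - u x\<bar>) \<longlonglongrightarrow> ennreal \<bar>0 - u x\<bar>"
      using LIMSEQ_subseq_LIMSEQ[OF elim(2) r]
      by (intro tendsto_intros) (auto simp: o_def)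
    moreover have "(\<lambda>n. ennreal \<bar>f (r n) x - u x\<bar>) \<longlonglongrightarrow> 0"
      by (rule tendsto_sandwich[OF _ _ tendsto_const e0]) (use elim in auto)
    ultimately have "ennreal \<bar>0 - u x\<bar> = 0" by (rule LIMSEQ_unique)
    then show ?case by simp
  qed
  obtain n where n: "?e n < ennreal (1/2)"
    using order_tendstoD(2)[OF e0, of "ennreal (1/2)"] eventually_happens'[OF sequentially_bot] by force
  obtain d where d: "d > 0" "\<And>x. dist x x0 < d \<Longrightarrow> dist (f (r n) x) (f (r n) x0) < 1/2"
    using cont[of "r n"] unfolding continuous_at_eps_delta by (metis half_gt_zero_iff zero_less_one)
  have "AE x in lebesgue_on \<Omega>. \<bar>f (r n) x\<bar> < 1/2"
    using AEall u0
  proof eventually_elim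
    case (elim x)
    then have "ennreal \<bar>f (r n) x\<bar> \<le> ?e n" by (metis diff_zero)
    then have "ennreal \<bar>f (r n) x\<bar> < ennreal (1/2)" using n by simp
    then show ?case by (subst (asm) ennreal_less_iff) auto
  qed
  from AE_lebesgue_on_open_witness[OF assms(1,2) d(1) this] d(2) f1[of "r n"]
  show False by (force simp: dist_real_def dist_commute)
qed

subsection \<open>An upper bound for the Gagliardo integral\<close>

lemma powr2_interval:
  fixes x :: real
  assumes "1 \<le> x"
  obtains j :: nat where "2 powr real j \<le> x" "x < 2 powr (real j + 1)"
proof
  let ?j = "nat \<lfloor>log 2 x\<rfloor>"
  have "0 \<le> log 2 x" using assms by simp
  then have j: "real ?j \<le> log 2 x" "log 2 x < real ?j + 1" by linarith+
  show "2 powr real ?j \<le> x" using j(1) assms by (subst (asm) le_log_iff) auto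
  show "x < 2 powr (real ?j + 1)" using j(2) assms by (subst (asm) log_less_iff) auto
qed

lemma nn_integral_indicator_cball:
  fixes x :: "'a::euclidean_space"
  assumes "0 \<le> r" "0 \<le> a"
  shows "(\<integral>\<^sup>+y. ennreal a * indicator (cball x r) y \<partial>lborel)
    = ennreal (a * (unit_ball_vol DIM('a) * r ^ DIM('a)))"
  using assms by (simp add: nn_integral_cmult_indicator emeasure_cball ennreal_mult)

text \<open>\<open>r\<close> stands for the rescaled distance l |x - y|. On the shell 2^(-j-1) < r
  \<le> 2^(-j), or 2^j \<le> r < 2^(j+1), numerator and denominator are bounded separately, which
  makes the sign of \<open>p - 2 * n\<close> irrelevant.\<close>

lemma truncated_power_dyadic:
  fixes r p n :: real
  assumes "0 < r" "0 < n" "0 < p"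
  shows "(\<exists>j::nat. r \<le> 2 powr (- real j) \<and>
             min 2 r powr p / r powr (2 * n) \<le> 2 powr (2 * n + real j * (2 * n - p))) \<or>
         (\<exists>j::nat. r \<le> 2 powr (real j + 1) \<and>
             min 2 r powr p / r powr (2 * n) \<le> 2 powr (p - 2 * n * real j))"
proof (cases "r \<le> 1")
  case True
  then obtain j :: nat where j: "2 powr real j \<le> 1 / r" "1 / r < 2 powr (real j + 1)"
    using powr2_interval[of "1 / r"] assms by auto
  have r1: "r \<le> 2 powr (- real j)"
    using j(1) assms by (simp add: powr_minus field_simps)
  have r2: "2 powr (- (real j + 1)) \<le> r"
    unfolding powr_minus using j(2) assms by (simp add: field_simps)
  have "min 2 r powr p / r powr (2 * n)
      \<le> (2 powr (- real j)) powr p / (2 powr (- (real j + 1))) powr (2 * n)"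
    using assms r1 r2 by (intro frac_le powr_mono2) auto
  also have "\<dots> = 2 powr (2 * n + real j * (2 * n - p))"
    unfolding powr_powr powr_diff[symmetric] by (simp add: algebra_simps)
  finally show ?thesis using r1 by blast
next
  case False
  then obtain j :: nat where j: "2 powr real j \<le> r" "r < 2 powr (real j + 1)"
    using powr2_interval[of r] assms by auto
  have "min 2 r powr p / r powr (2 * n) \<le> 2 powr p / (2 powr real j) powr (2 * n)"
    using assms j by (intro frac_le powr_mono2) auto
  also have "\<dots> = 2 powr (p - 2 * n * real j)"
    unfolding powr_powr powr_diff[symmetric] by (simp add: algebra_simps)
  finally show ?thesis using j by (meson less_imp_le)
qed

text \<open>In the variable l (y - x) the integral scales like l^(2 N - N). What remains converges:
  near the diagonal it behaves like r^(p - 2 N) with p > N, far away like r^(-2 N). A sum over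
  dyadic balls takes the place of polar coordinates.\<close>

lemma truncated_kernel_integral_bound:
  fixes p :: real
  assumes "real DIM('a::euclidean_space) < p"
  shows "\<exists>C\<ge>0. \<forall>l>0. \<forall>x::'a.
    (\<integral>\<^sup>+y. ennreal (min 2 (l * norm (x - y)) powr p / norm (x - y) powr (2 * real DIM('a))) \<partial>lborel)
      \<le> ennreal (C * l ^ DIM('a))"
proof -
  define n where "n = real DIM('a)"
  have n: "0 < n" by (simp add: n_def)
  have p: "n < p" using assms by (simp add: n_def)
  define V where "V = unit_ball_vol n"
  have V: "0 \<le> V" by (simp add: V_def n_def)
  \<comment> \<open>Ratios of the two geometric series to come. A near shell contributes 2^(j (2 n -
    p)) times its volume 2^(-j n), a far one 2^(-2 n j) times 2^(j n), up to constants.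
    \<open>q1 < 1\<close> is exactly the condition n < p.\<close>
  define q1 where "q1 = 2 powr (n - p)"
  define q2 where "q2 = 2 powr (- n)"
  have q: "0 < q1" "q1 < 1" "0 < q2" "q2 < 1"
    using n p by (auto simp: q1_def q2_def powr_less_one)
  define C where "C = V * (2 powr (2 * n) / (1 - q1) + 2 powr (p + n) / (1 - q2))"
  have "0 \<le> C" using V q by (simp add: C_def)
  moreover have "(\<integral>\<^sup>+y. ennreal (min 2 (l * norm (x - y)) powr p / norm (x - y) powr (2 * n)) \<partial>lborel)
      \<le> ennreal (C * l ^ DIM('a))" if l: "0 < l" for l :: real and x :: 'a
  proof -
    \<comment> \<open>Heights \<open>a\<close>, \<open>b\<close> and radii \<open>R\<close>,
      \<open>S\<close> of the near and far balls; the factor \<open>l powr (2 * n)\<close> comes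
      from |x - y| = r / l. Full balls instead of shells cost only a constant.\<close>
    define a where "a j = l powr (2 * n) * 2 powr (2 * n + real j * (2 * n - p))" for j :: nat
    define b where "b j = l powr (2 * n) * 2 powr (p - 2 * n * real j)" for j :: nat
    define R where "R j = 2 powr (- real j) / l" for j :: nat
    define S where "S j = 2 powr (real j + 1) / l" for j :: nat
    define h where "h j y = ennreal (a j) * indicator (cball x (R j)) y
        + ennreal (b j) * indicator (cball x (S j)) y" for j :: nat and y
    have nonneg: "0 \<le> a j" "0 \<le> b j" "0 \<le> R j" "0 \<le> S j" for j
      using l by (auto simp: a_def b_def R_def S_def)
    have meas [measurable]: "(\<lambda>y. ennreal (a j) * indicator (cball x (R j)) y) \<in> borel_measurable lborel"
      "(\<lambda>y. ennreal (b j) * indicator (cball x (S j)) y) \<in> borel_measurable lborel" for j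
      by (auto intro!: borel_measurable_times_ennreal borel_measurable_indicator)
    \<comment> \<open>A single term of the series already dominates the kernel, and the others are
      nonnegative. On the diagonal the kernel is 0 / 0 = 0.\<close>
    have pw: "ennreal (min 2 (l * norm (x - y)) powr p / norm (x - y) powr (2 * n)) \<le> (\<Sum>j. h j y)" for y
    proof (cases "y = x")
      case False
      define r where "r = l * norm (x - y)"
      have r: "0 < r" using False l by (simp add: r_def)
      have eq: "min 2 r powr p / norm (x - y) powr (2 * n) = l powr (2 * n) * (min 2 r powr p / r powr (2 * n))"
        using l False by (simp add: r_def powr_mult)
      have "\<exists>j. ennreal (min 2 r powr p / norm (x - y) powr (2 * n)) \<le> h j y"
        using truncated_power_dyadic[OF r n, of p, OF less_trans[OF n p]]
      proof (elim disjE exE conjE)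
        fix j :: nat
        assume j: "r \<le> 2 powr (- real j)"
          "min 2 r powr p / r powr (2 * n) \<le> 2 powr (2 * n + real j * (2 * n - p))"
        then have "y \<in> cball x (R j)"
          using l by (simp add: R_def r_def dist_norm field_simps)
        moreover have "ennreal (min 2 r powr p / norm (x - y) powr (2 * n)) \<le> ennreal (a j)"
          unfolding eq a_def using j by (intro ennreal_leI mult_left_mono) auto
        ultimately have "ennreal (min 2 r powr p / norm (x - y) powr (2 * n)) \<le> h j y"
          unfolding h_def by (auto intro: add_increasing2)
        then show ?thesis ..
      next
        fix j :: nat
        assume j: "r \<le> 2 powr (real j + 1)"
          "min 2 r powr p / r powr (2 * n) \<le> 2 powr (p - 2 * n * real j)"
        then have "y \<in> cball x (S j)"
          using l by (simp add: S_def r_def dist_norm field_simps)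
        moreover have "ennreal (min 2 r powr p / norm (x - y) powr (2 * n)) \<le> ennreal (b j)"
          unfolding eq b_def using j by (intro ennreal_leI mult_left_mono) auto
        ultimately have "ennreal (min 2 r powr p / norm (x - y) powr (2 * n)) \<le> h j y"
          unfolding h_def by (auto intro: add_increasing)
        then show ?thesis ..
      qed
      then obtain j where "ennreal (min 2 r powr p / norm (x - y) powr (2 * n)) \<le> h j y" ..
      also have "h j y \<le> (\<Sum>j. h j y)"
        using sum_le_suminf[of "\<lambda>j. h j y" "{j}"] by simp
      finally show ?thesis by (simp add: r_def)
    qed simp
    have int: "(\<integral>\<^sup>+y. h j y \<partial>lborel)
        = ennreal (l ^ DIM('a) * V * (2 powr (2 * n) * q1 ^ j + 2 powr (p + n) * q2 ^ j))" for j
    proof -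
      have l2: "l powr (2 * n) = l powr n * l powr n"
        by (simp add: powr_add[symmetric])
      have lN: "l ^ DIM('a) = l powr n" using l by (simp add: powr_realpow n_def)
      have lne: "l powr n / l powr n = 1" using l by simp
      have la: "a j * (V * R j ^ DIM('a)) = l ^ DIM('a) * V * (2 powr (2 * n) * q1 ^ j)"
      proof -
        have R: "R j ^ DIM('a) = 2 powr (- real j * n) / l powr n"
          using l by (simp add: R_def powr_realpow[symmetric] powr_divide powr_powr n_def)
        have q: "q1 ^ j = 2 powr (real j * (n - p))"
          by (simp add: q1_def powr_realpow[symmetric] powr_powr mult.commute)
        have e: "2 powr (2 * n + real j * (2 * n - p)) * 2 powr (- real j * n)
            = 2 powr (2 * n) * 2 powr (real j * (n - p))"
          unfolding powr_add[symmetric] by (simp add: algebra_simps)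
        have "a j * (V * R j ^ DIM('a)) = (l powr n / l powr n) * (l powr n * V)
            * (2 powr (2 * n + real j * (2 * n - p)) * 2 powr (- real j * n))"
          unfolding a_def R l2 by simp
        then show ?thesis unfolding e q lN lne by simp
      qed
      have lb: "b j * (V * S j ^ DIM('a)) = l ^ DIM('a) * V * (2 powr (p + n) * q2 ^ j)"
      proof -
        have S: "S j ^ DIM('a) = 2 powr ((real j + 1) * n) / l powr n"
          using l by (simp add: S_def powr_realpow[symmetric] powr_divide powr_powr n_def)
        have q: "q2 ^ j = 2 powr (- n * real j)"
          by (simp add: q2_def powr_realpow[symmetric] powr_powr mult.commute)
        have e: "2 powr (p - 2 * n * real j) * 2 powr ((real j + 1) * n)
            = 2 powr (p + n) * 2 powr (- n * real j)"
          unfolding powr_add[symmetric] by (simp add: algebra_simps)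
        have "b j * (V * S j ^ DIM('a)) = (l powr n / l powr n) * (l powr n * V)
            * (2 powr (p - 2 * n * real j) * 2 powr ((real j + 1) * n))"
          unfolding b_def S l2 by simp
        then show ?thesis unfolding e q lN lne by simp
      qed
      have "(\<integral>\<^sup>+y. h j y \<partial>lborel) = ennreal (a j * (V * R j ^ DIM('a))) + ennreal (b j * (V * S j ^ DIM('a)))"
        unfolding h_def using nonneg[of j]
        by (subst nn_integral_add[OF meas]) (simp add: nn_integral_indicator_cball V_def n_def)
      then show ?thesis unfolding la lb using l V q
        by (subst (asm) ennreal_plus[symmetric]) (auto simp: algebra_simps)
    qed
    have sums: "(\<lambda>j. l ^ DIM('a) * V * (2 powr (2 * n) * q1 ^ j + 2 powr (p + n) * q2 ^ j)) sums (C * l ^ DIM('a))"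
    proof -
      have "(\<lambda>j. l ^ DIM('a) * V * (2 powr (2 * n) * q1 ^ j + 2 powr (p + n) * q2 ^ j)) sums
        (l ^ DIM('a) * V * (2 powr (2 * n) * (1 / (1 - q1)) + 2 powr (p + n) * (1 / (1 - q2))))"
        using q by (intro sums_mult sums_add geometric_sums) auto
      then show ?thesis by (simp add: C_def mult_ac)
    qed
    have "(\<integral>\<^sup>+y. ennreal (min 2 (l * norm (x - y)) powr p / norm (x - y) powr (2 * n)) \<partial>lborel)
        \<le> (\<integral>\<^sup>+y. (\<Sum>j. h j y) \<partial>lborel)"
      by (intro nn_integral_mono pw)
    also have "\<dots> = (\<Sum>j. \<integral>\<^sup>+y. h j y \<partial>lborel)"
      by (intro nn_integral_suminf) (unfold h_def, measurable)
    also have "\<dots> = ennreal (C * l ^ DIM('a))"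
      unfolding int using sums l V q
      by (subst suminf_ennreal2) (auto simp: sums_iff)
    finally show ?thesis .
  qed
  ultimately show ?thesis unfolding n_def by blast
qed

text \<open>Since \<open>f\<close> is constant on \<Omega> outside \<open>D\<close>, only pairs with
  a point in \<open>D\<close> contribute. The kernel integral is uniform in the remaining variable,
  so the double integral costs the volume of \<open>D\<close>, once for each of the two positions.
  \<open>D\<close> is the supporting ball for bumps and \<Omega> itself for oscillations.\<close>

lemma gagliardo_integral_bound:
  fixes f :: "'a::euclidean_space \<Rightarrow> real"
  assumes "open \<Omega>" and [measurable]: "D \<in> sets borel"
    and D: "emeasure lborel D \<le> ennreal V"
    and pos: "0 < p" "0 \<le> A" "0 \<le> V" "0 < l" "0 \<le> C"
    and inc: "\<And>x y. \<bar>f x - f y\<bar> \<le> A * min 2 (l * norm (x - y))"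
    and off: "\<And>x y. \<lbrakk>x \<in> \<Omega>; y \<in> \<Omega>; x \<notin> D; y \<notin> D\<rbrakk> \<Longrightarrow> f x = f y"
    and C: "\<And>x::'a. (\<integral>\<^sup>+y. ennreal (min 2 (l * norm (x - y)) powr p / norm (x - y) powr (2 * real DIM('a))) \<partial>lborel)
      \<le> ennreal (C * l ^ DIM('a))"
  shows "(\<integral>\<^sup>+x. (\<integral>\<^sup>+y. ennreal (\<bar>f x - f y\<bar> powr p / norm (x - y) powr (2 * real DIM('a)))
            \<partial>lebesgue_on \<Omega>) \<partial>lebesgue_on \<Omega>)
      \<le> ennreal (2 * V * A powr p * C * l ^ DIM('a))"
proof -
  define k where "k x y = ennreal (min 2 (l * norm (x - y)) powr p / norm (x - y) powr (2 * real DIM('a)))"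
    for x y :: 'a
  let ?K = "ennreal (A powr p)" and ?M = "ennreal (C * l ^ DIM('a))"
  have k_meas [measurable]: "(\<lambda>z. k (fst z) (snd z)) \<in> borel_measurable (lborel \<Otimes>\<^sub>M lborel)"
    unfolding k_def by measurable
  have k_meas' [measurable]: "k x \<in> borel_measurable lborel" for x
    unfolding k_def by measurable
  have sym: "k x y = k y x" for x y by (simp add: k_def norm_minus_commute)
  have kM: "(\<integral>\<^sup>+y. k x y \<partial>lborel) \<le> ?M" for x using C[of x] by (simp add: k_def)
  have pw: "ennreal (\<bar>f x - f y\<bar> powr p / norm (x - y) powr (2 * real DIM('a))) * indicator \<Omega> y * indicator \<Omega> x
      \<le> ?K * (indicator D x * k x y) + ?K * (indicator D y * k x y)" for x y
  proof (cases "x \<in> \<Omega> \<and> y \<in> \<Omega> \<and> (x \<in> D \<or> y \<in> D)")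
    case True
    have "\<bar>f x - f y\<bar> powr p \<le> (A * min 2 (l * norm (x - y))) powr p"
      using inc pos by (intro powr_mono2) auto
    also have "\<dots> = A powr p * min 2 (l * norm (x - y)) powr p"
      using pos by (simp add: powr_mult)
    finally have "\<bar>f x - f y\<bar> powr p / norm (x - y) powr (2 * real DIM('a))
        \<le> A powr p * (min 2 (l * norm (x - y)) powr p / norm (x - y) powr (2 * real DIM('a)))"
      by (simp add: divide_right_mono)
    then have "ennreal (\<bar>f x - f y\<bar> powr p / norm (x - y) powr (2 * real DIM('a))) \<le> ?K * k x y"
      unfolding k_def by (subst ennreal_mult[symmetric]) (auto intro: ennreal_leI)
    then show ?thesis using True
      by (auto simp: indicator_def intro: add_increasing add_increasing2)
  next
    case False
    then show ?thesis using off[of x y] by (auto simp: indicator_def)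
  qed
  have "(\<integral>\<^sup>+x. (\<integral>\<^sup>+y. ennreal (\<bar>f x - f y\<bar> powr p / norm (x - y) powr (2 * real DIM('a)))
            \<partial>lebesgue_on \<Omega>) \<partial>lebesgue_on \<Omega>)
      \<le> (\<integral>\<^sup>+x. (\<integral>\<^sup>+y. ?K * (indicator D x * k x y) + ?K * (indicator D y * k x y) \<partial>lborel) \<partial>lborel)"
    using \<open>open \<Omega>\<close>
  proof (simp add: nn_integral_lebesgue_on, intro nn_integral_mono)
    fix x
    show "(\<integral>\<^sup>+y. ennreal (\<bar>f x - f y\<bar> powr p / norm (x - y) powr (2 * real DIM('a))) * indicator \<Omega> y \<partial>lborel) * indicator \<Omega> x
       \<le> (\<integral>\<^sup>+y. ?K * (indicator D x * k x y) + ?K * (indicator D y * k x y) \<partial>lborel)"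
    proof (cases "x \<in> \<Omega>")
      case True
      then show ?thesis using pw[of x] by (auto intro!: nn_integral_mono)
    qed simp
  qed
  also have "\<dots> = ?K * (\<integral>\<^sup>+x. \<integral>\<^sup>+y. indicator D x * k x y \<partial>lborel \<partial>lborel)
      + ?K * (\<integral>\<^sup>+x. \<integral>\<^sup>+y. indicator D y * k x y \<partial>lborel \<partial>lborel)"
    by (simp add: nn_integral_add nn_integral_cmult)
  \<comment> \<open>Tonelli together with the symmetry of \<open>k\<close>; this produces the factor
    2.\<close>
  also have "(\<integral>\<^sup>+x. \<integral>\<^sup>+y. indicator D y * k x y \<partial>lborel \<partial>lborel)
      = (\<integral>\<^sup>+x. \<integral>\<^sup>+y. indicator D x * k x y \<partial>lborel \<partial>lborel)"
    using lborel_pair.Fubini'[of "\<lambda>x y. indicator D y * k x y"] by (simp add: sym split_beta')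
  also have "(\<integral>\<^sup>+x. \<integral>\<^sup>+y. indicator D x * k x y \<partial>lborel \<partial>lborel)
      \<le> (\<integral>\<^sup>+x. ?M * indicator D x \<partial>lborel)"
  proof (intro nn_integral_mono)
    fix x
    show "(\<integral>\<^sup>+y. indicator D x * k x y \<partial>lborel) \<le> ?M * indicator D x"
      using kM[of x] by (simp add: nn_integral_cmult mult.commute[of _ "indicator D x"] mult_left_mono)
  qed
  also have "\<dots> \<le> ?M * ennreal V"
    using D by (simp add: nn_integral_cmult_indicator mult_left_mono)
  also have "?K * (?M * ennreal V) + ?K * (?M * ennreal V) = ennreal (2 * V * A powr p * C * l ^ DIM('a))"
    using pos by (simp add: ennreal_mult[symmetric] ennreal_plus[symmetric] del: ennreal_plus)
  finally show ?thesis by (simp add: add_mono mult_left_mono)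
qed

subsection \<open>Bumps and oscillations in fractional spaces\<close>

lemma gagliardo_const_pos:
  assumes "0 < s" "s < 1" "1 \<le> p" "1 \<le> N"
  shows "0 < gagliardo_const N s p"
proof -
  have "0 < p * s" using assms by simp
  moreover have "1 \<le> real N" using assms by simp
  ultimately have "0 < (p * s + p + real N - 2) / 2" using assms(3) by simp
  then have "0 < Gamma ((p * s + p + real N - 2) / 2)" by (rule Gamma_real_pos)
  moreover have "0 < Gamma (1 - s)" using assms by (intro Gamma_real_pos) auto
  ultimately show ?thesis using assms unfolding gagliardo_const_def
    by (intro divide_pos_pos mult_pos_pos) auto
qed

text \<open>Only pairs (x, z) with x in a fixed ball and z in a small ball of centre y are kept. The
  centre may depend on x in any way: the inner integral is bounded below by a constant that involves
  only the radius, so no measurable choice of y is required. Passing from \<open>w\<close> to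
  \<open>f\<close> changes the inner and the outer integrand only on null sets.\<close>

lemma gagliardo_integral_lower:
  fixes f w :: "'a::euclidean_space \<Rightarrow> real"
  assumes "open \<Omega>" and E: "ball x1 r0 \<subseteq> \<Omega>"
    and pos: "0 \<le> r0" "0 \<le> r" "0 < A" "0 < q" "0 < R" "0 \<le> a"
    and ex: "\<And>x. x \<in> ball x1 r0 \<Longrightarrow>
      \<exists>y. ball y r \<subseteq> \<Omega> \<and> (\<forall>z\<in>ball y r. A \<le> \<bar>f x - f z\<bar> \<and> norm (x - z) \<le> R)"
    and w: "AE x in lebesgue_on \<Omega>. w x = f x"
  shows "ennreal (unit_ball_vol DIM('a) * r0 ^ DIM('a) * (unit_ball_vol DIM('a) * r ^ DIM('a)) * (A powr q / R powr a))
     \<le> (\<integral>\<^sup>+x. (\<integral>\<^sup>+y. ennreal (\<bar>w x - w y\<bar> powr q / norm (x - y) powr a) \<partial>lebesgue_on \<Omega>) \<partial>lebesgue_on \<Omega>)"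
proof -
  let ?c = "ennreal (A powr q / R powr a)"
  let ?b = "\<lambda>r. ennreal (unit_ball_vol DIM('a) * r ^ DIM('a))"
  have "(\<integral>\<^sup>+x. (\<integral>\<^sup>+y. ennreal (\<bar>w x - w y\<bar> powr q / norm (x - y) powr a) \<partial>lebesgue_on \<Omega>) \<partial>lebesgue_on \<Omega>)
    = (\<integral>\<^sup>+x. (\<integral>\<^sup>+y. ennreal (\<bar>f x - f y\<bar> powr q / norm (x - y) powr a) \<partial>lebesgue_on \<Omega>) \<partial>lebesgue_on \<Omega>)"
  proof (rule nn_integral_cong_AE)
    show "AE x in lebesgue_on \<Omega>. (\<integral>\<^sup>+y. ennreal (\<bar>w x - w y\<bar> powr q / norm (x - y) powr a) \<partial>lebesgue_on \<Omega>)
      = (\<integral>\<^sup>+y. ennreal (\<bar>f x - f y\<bar> powr q / norm (x - y) powr a) \<partial>lebesgue_on \<Omega>)"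
      using w
    proof eventually_elim
      case (elim x)
      show ?case
        by (rule nn_integral_cong_AE) (use w in \<open>eventually_elim, simp add: elim\<close>)
    qed
  qed
  moreover have "?c * ?b r * indicator (ball x1 r0) x
    \<le> (\<integral>\<^sup>+y. ennreal (\<bar>f x - f y\<bar> powr q / norm (x - y) powr a) * indicator \<Omega> y \<partial>lborel) * indicator \<Omega> x" for x
  proof (cases "x \<in> ball x1 r0")
    case True
    obtain y where y: "ball y r \<subseteq> \<Omega>" "\<forall>z\<in>ball y r. A \<le> \<bar>f x - f z\<bar> \<and> norm (x - z) \<le> R"
      using ex[OF True] by blast
    have "?c * ?b r = (\<integral>\<^sup>+z. ?c * indicator (ball y r) z \<partial>lborel)"
      using pos by (simp add: nn_integral_cmult_indicator emeasure_ball)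
    also have "\<dots> \<le> (\<integral>\<^sup>+z. ennreal (\<bar>f x - f z\<bar> powr q / norm (x - z) powr a) * indicator \<Omega> z \<partial>lborel)"
    proof (rule nn_integral_mono)
      fix z
      show "?c * indicator (ball y r) z
        \<le> ennreal (\<bar>f x - f z\<bar> powr q / norm (x - z) powr a) * indicator \<Omega> z"
      proof (cases "z \<in> ball y r")
        case z: True
        have d: "A \<le> \<bar>f x - f z\<bar>" "norm (x - z) \<le> R" using y z by auto
        then have "x \<noteq> z" using pos by auto
        then have "A powr q / R powr a \<le> \<bar>f x - f z\<bar> powr q / norm (x - z) powr a"
          using d pos by (intro frac_le powr_mono2) auto
        then have "?c \<le> ennreal (\<bar>f x - f z\<bar> powr q / norm (x - z) powr a)" by (rule ennreal_leI)
        moreover have "z \<in> \<Omega>" using y z by auto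
        ultimately show ?thesis using z by simp
      qed simp
    qed
    finally show ?thesis using True E by auto
  qed simp
  then have "(\<integral>\<^sup>+x. ?c * ?b r * indicator (ball x1 r0) x \<partial>lborel)
     \<le> (\<integral>\<^sup>+x. (\<integral>\<^sup>+y. ennreal (\<bar>f x - f y\<bar> powr q / norm (x - y) powr a) \<partial>lebesgue_on \<Omega>) \<partial>lebesgue_on \<Omega>)"
    using \<open>open \<Omega>\<close> by (simp add: nn_integral_lebesgue_on nn_integral_mono)
  moreover have "(\<integral>\<^sup>+x. ?c * ?b r * indicator (ball x1 r0) x \<partial>lborel)
    = ennreal (unit_ball_vol DIM('a) * r0 ^ DIM('a) * (unit_ball_vol DIM('a) * r ^ DIM('a)) * (A powr q / R powr a))"
    using pos
    by (subst nn_integral_cmult_indicator) (simp_all add: emeasure_ball ennreal_mult[symmetric] mult_ac)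
  ultimately show ?thesis by simp
qed

lemma sobolev_seminorm_fractional_ge:
  fixes \<Omega> :: "'a::euclidean_space set"
  assumes "0 < t" "t < 1" "1 \<le> q" "0 \<le> m"
    and "ennreal m \<le> (\<integral>\<^sup>+x. (\<integral>\<^sup>+y. ennreal (\<bar>w x - w y\<bar> powr q / norm (x - y) powr (real DIM('a) + t * q))
            \<partial>lebesgue_on \<Omega>) \<partial>lebesgue_on \<Omega>)"
  shows "ennreal ((gagliardo_const DIM('a) t q * m) powr (1 / q)) \<le> sobolev_seminorm \<Omega> t q w"
proof -
  have g: "0 < gagliardo_const DIM('a) t q" using assms by (intro gagliardo_const_pos) (auto simp: Suc_le_eq)
  have "enn_powr (ennreal (gagliardo_const DIM('a) t q) * ennreal m) (1 / q) \<le> sobolev_seminorm \<Omega> t q w"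
    unfolding sobolev_seminorm_def using assms
    by (auto intro!: enn_powr_mono mult_left_mono)
  then show ?thesis using g assms(4) by (simp add: ennreal_mult[symmetric] enn_powr_ennreal)
qed

lemma sobolev_seminorm_fractional_le:
  fixes \<Omega> :: "'a::euclidean_space set"
  assumes "0 < t" "t < 1" "1 \<le> q" "0 \<le> m"
    and "(\<integral>\<^sup>+x. (\<integral>\<^sup>+y. ennreal (\<bar>w x - w y\<bar> powr q / norm (x - y) powr (real DIM('a) + t * q))
            \<partial>lebesgue_on \<Omega>) \<partial>lebesgue_on \<Omega>) \<le> ennreal m"
  shows "sobolev_seminorm \<Omega> t q w \<le> ennreal ((gagliardo_const DIM('a) t q * m) powr (1 / q))"
proof -
  have g: "0 < gagliardo_const DIM('a) t q" using assms by (intro gagliardo_const_pos) (auto simp: Suc_le_eq)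
  have "sobolev_seminorm \<Omega> t q w \<le> enn_powr (ennreal (gagliardo_const DIM('a) t q) * ennreal m) (1 / q)"
    unfolding sobolev_seminorm_def using assms
    by (auto intro!: enn_powr_mono mult_left_mono)
  then show ?thesis using g assms(4) by (simp add: ennreal_mult[symmetric] enn_powr_ennreal)
qed

lemma Lp_norm_le:
  fixes \<Omega> :: "'a::euclidean_space set"
  assumes "open \<Omega>" "D \<in> sets borel" "emeasure lborel D \<le> ennreal V" "0 < p" "0 \<le> M" "0 \<le> V"
    and "\<And>x. x \<in> \<Omega> \<Longrightarrow> norm (u x) \<le> M * indicator D x"
  shows "Lp_norm \<Omega> p u \<le> ennreal ((M powr p * V) powr (1 / p))"
proof -
  have "(\<integral>\<^sup>+x. ennreal (norm (u x) powr p) \<partial>lebesgue_on \<Omega>)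
      \<le> (\<integral>\<^sup>+x. ennreal (M powr p) * indicator D x \<partial>lborel)"
    using \<open>open \<Omega>\<close>
  proof (simp add: nn_integral_lebesgue_on del: nn_integral_cmult_indicator, intro nn_integral_mono)
    fix x
    show "ennreal (norm (u x) powr p) * indicator \<Omega> x \<le> ennreal (M powr p) * indicator D x"
    proof (cases "x \<in> \<Omega> \<and> x \<in> D")
      case True
      then show ?thesis using assms(4,5) assms(7)[of x] by (auto intro!: ennreal_leI powr_mono2)
    next
      case False
      then show ?thesis using assms(7)[of x] by (auto simp: indicator_def)
    qed
  qed
  also have "\<dots> \<le> ennreal (M powr p) * ennreal V"
    using assms(2,3) by (simp add: nn_integral_cmult_indicator mult_left_mono)
  finally have "enn_powr (\<integral>\<^sup>+x. ennreal (norm (u x) powr p) \<partial>lebesgue_on \<Omega>) (1 / p)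
      \<le> enn_powr (ennreal (M powr p * V)) (1 / p)"
    using assms by (intro enn_powr_mono) (auto simp: ennreal_mult)
  then show ?thesis using assms by (simp add: Lp_norm_def enn_powr_ennreal)
qed

lemma sobolev_space_bounded:
  fixes \<Omega> :: "'a::euclidean_space set"
  assumes "0 < q" "s \<noteq> 0" "0 \<le> A" "0 \<le> B" "u \<in> borel_measurable (lebesgue_on \<Omega>)"
    and "Lp_norm \<Omega> q u \<le> ennreal A" "sobolev_seminorm \<Omega> s q u \<le> ennreal B"
  shows "u \<in> sobolev_space \<Omega> s (ereal q) \<and>
     sobolev_norm \<Omega> s (ereal q) u \<le> ennreal ((B powr q + A powr q) powr (1 / q))"
  using sobolev_norm_le[OF assms(1-4,6,7)] assms
  by (auto simp: sobolev_space_def intro: le_less_trans)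

lemma continuous_borel_measurable_lebesgue_on:
  fixes f :: "'a::euclidean_space \<Rightarrow> 'b::euclidean_space"
  assumes "continuous_on UNIV f"
  shows "f \<in> borel_measurable (lebesgue_on \<Omega>)"
  using borel_measurable_continuous_onI[OF assms]
  by (intro measurable_restrict_space1 measurable_completion) simp

text \<open>The outer square makes the truncated paraboloid continuously differentiable across the
  sphere of radius 1/l, since max(0, t)^2 is. Hence the same family serves fractional order and
  order one, with an explicit gradient.\<close>

definition bump :: "'a::euclidean_space \<Rightarrow> real \<Rightarrow> 'a \<Rightarrow> real" where
  "bump x0 l x = (max 0 (1 - (l * norm (x - x0))\<^sup>2))\<^sup>2"

text \<open>A seminorm of order s grows like l^s at frequency l; the amplitude cancels this
  growth.\<close>

definition osc :: "'a::euclidean_space \<Rightarrow> real \<Rightarrow> real \<Rightarrow> 'a \<Rightarrow> real" where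
  "osc e s l x = l powr (- s) * sin (l * (x \<bullet> e))"

lemma continuous_bump: "continuous_on UNIV (bump x0 l)"
  unfolding bump_def by (intro continuous_intros)

lemma continuous_osc: "continuous_on UNIV (osc e s l)"
  unfolding osc_def by (intro continuous_intros)

section \<open>Size, support and increments of the two families\<close>

lemma bump_center: "bump x0 l x0 = 1"
  by (simp add: bump_def)

lemma bump_outside:
  assumes "0 < l" "x \<notin> ball x0 (1 / l)"
  shows "bump x0 l x = 0"
proof -
  have "1 \<le> l * norm (x - x0)"
    using assms by (simp add: dist_norm norm_minus_commute field_simps)
  then have "1 \<le> (l * norm (x - x0))\<^sup>2" by (rule one_le_power)
  then show ?thesis by (simp add: bump_def)
qed

lemma bump_bounds: "0 \<le> bump x0 l x" "bump x0 l x \<le> 1"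
  by (auto simp: bump_def power_le_one)

text \<open>The bump is (1 - m^2)^2 with m = min(1, l |x - x0|), which is l-Lipschitz with values in
  [0, 1]. Squaring is 2-Lipschitz there and occurs twice, hence the 4. The factor 1 and the
  truncation at 2 match the form of the kernel estimate.\<close>

lemma bump_increment:
  assumes "0 < l"
  shows "\<bar>bump x0 l x - bump x0 l y\<bar> \<le> 1 * min 2 (4 * l * norm (x - y))"
proof -
  define m where "m z = min 1 (l * norm (z - x0))" for z
  have m: "0 \<le> m z" "m z \<le> 1" for z using assms by (auto simp: m_def)
  have b: "bump x0 l z = (1 - (m z)\<^sup>2)\<^sup>2" for z
  proof (cases "l * norm (z - x0) \<le> 1")
    case True
    then have "(l * norm (z - x0))\<^sup>2 \<le> 1" using assms by (simp add: power_le_one)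
    then show ?thesis using True by (simp add: bump_def m_def)
  next
    case False
    then have "1 \<le> (l * norm (z - x0))\<^sup>2" by (intro one_le_power) simp
    then show ?thesis using False by (simp add: bump_def m_def)
  qed
  have sq: "\<bar>u\<^sup>2 - v\<^sup>2\<bar> \<le> 2 * \<bar>u - v\<bar>" if "0 \<le> u" "u \<le> 1" "0 \<le> v" "v \<le> 1" for u v :: real
  proof -
    have "\<bar>u\<^sup>2 - v\<^sup>2\<bar> = \<bar>u + v\<bar> * \<bar>u - v\<bar>"
      by (simp add: power2_eq_square square_diff_square_factored abs_mult)
    also have "\<dots> \<le> 2 * \<bar>u - v\<bar>" using that by (intro mult_right_mono) auto
    finally show ?thesis .
  qed
  have "\<bar>bump x0 l x - bump x0 l y\<bar> \<le> 2 * \<bar>(1 - (m x)\<^sup>2) - (1 - (m y)\<^sup>2)\<bar>"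
    unfolding b using m by (intro sq) (auto simp: power_le_one)
  also have "\<dots> = 2 * \<bar>(m y)\<^sup>2 - (m x)\<^sup>2\<bar>" by simp
  also have "\<dots> \<le> 2 * (2 * \<bar>m y - m x\<bar>)" using m by (intro mult_left_mono sq) auto
  also have "\<bar>m y - m x\<bar> \<le> \<bar>l * norm (y - x0) - l * norm (x - x0)\<bar>" by (auto simp: m_def)
  also have "\<dots> = l * \<bar>norm (y - x0) - norm (x - x0)\<bar>"
    using assms by (simp add: right_diff_distrib[symmetric] abs_mult)
  also have "\<bar>norm (y - x0) - norm (x - x0)\<bar> \<le> norm (x - y)"
    using norm_triangle_ineq3[of "y - x0" "x - x0"] by (simp add: norm_minus_commute)
  finally have "\<bar>bump x0 l x - bump x0 l y\<bar> \<le> 4 * l * norm (x - y)" using assms by simp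
  moreover have "\<bar>bump x0 l x - bump x0 l y\<bar> \<le> 2"
    using bump_bounds[of x0 l x] bump_bounds[of x0 l y] by linarith
  ultimately show ?thesis by simp
qed

lemma abs_sin_diff_le: "\<bar>sin a - sin b\<bar> \<le> \<bar>a - b\<bar>" for a b :: real
proof -
  have "\<bar>sin a - sin b\<bar> = 2 * \<bar>sin ((a - b) / 2)\<bar> * \<bar>cos ((a + b) / 2)\<bar>"
    by (simp add: sin_diff_sin abs_mult)
  also have "\<dots> \<le> 2 * \<bar>(a - b) / 2\<bar> * 1"
    by (intro mult_mono abs_sin_le_one abs_cos_le_one abs_sin_x_le_abs_x) auto
  finally show ?thesis by simp
qed

lemma abs_sin_inner_diff_le:
  assumes "0 < l" "norm e = 1"
  shows "\<bar>sin (l * (x \<bullet> e)) - sin (l * (y \<bullet> e))\<bar> \<le> l * norm (x - y)"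
proof -
  have "\<bar>sin (l * (x \<bullet> e)) - sin (l * (y \<bullet> e))\<bar> \<le> \<bar>l * (x \<bullet> e) - l * (y \<bullet> e)\<bar>"
    by (rule abs_sin_diff_le)
  also have "\<dots> = l * \<bar>(x - y) \<bullet> e\<bar>"
    using assms by (simp add: right_diff_distrib[symmetric] abs_mult inner_diff_left)
  also have "\<dots> \<le> l * norm (x - y)"
    using assms Cauchy_Schwarz_ineq2[of "x - y" e] by (intro mult_left_mono) auto
  finally show ?thesis .
qed

lemma osc_increment:
  assumes "0 < l" "norm e = 1"
  shows "\<bar>osc e s l x - osc e s l y\<bar> \<le> l powr (- s) * min 2 (l * norm (x - y))"
proof -
  have "\<bar>sin (l * (x \<bullet> e)) - sin (l * (y \<bullet> e))\<bar> \<le> 2"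
    using abs_sin_le_one[of "l * (x \<bullet> e)"] abs_sin_le_one[of "l * (y \<bullet> e)"] by linarith
  with abs_sin_inner_diff_le[OF assms, of x y] show ?thesis
    by (simp add: osc_def right_diff_distrib[symmetric] abs_mult mult_left_mono)
qed

lemma abs_osc_le: 
  assumes "1 \<le> l" "0 \<le> s"
  shows "\<bar>osc e s l x\<bar> \<le> 1"
proof -
  have "l powr (- s) \<le> 1 powr (- s)" using assms by (intro powr_mono2') auto
  then have "l powr (- s) * \<bar>sin (l * (x \<bullet> e))\<bar> \<le> 1 * 1" by (intro mult_mono) auto
  then show ?thesis by (simp add: osc_def abs_mult)
qed

text \<open>The convergence condition of the kernel estimate: p = N / s exceeds N because s <
  1.\<close>

lemma critical_exponent_gt:
  fixes s p n :: real
  assumes "0 < s" "s < 1" "s * p = n" "0 < n"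
  shows "n < p"
proof -
  have "0 < s * p" using assms by simp
  then have "0 < p" using \<open>0 < s\<close> by (simp only: zero_less_mult_iff, auto)
  then have "s * p < 1 * p" using \<open>s < 1\<close> by (rule mult_strict_right_mono[rotated])
  then show ?thesis using assms by simp
qed

lemma osc_fractional_bounded:
  fixes \<Omega> :: "'a::euclidean_space set"
  assumes "open \<Omega>" "bounded \<Omega>" "norm e = 1" "0 < s" "s < 1" "s * p = real DIM('a)"
  shows "\<exists>B. \<forall>l\<ge>1. osc e s l \<in> sobolev_space \<Omega> s (ereal p) \<and>
     sobolev_norm \<Omega> s (ereal p) (osc e s l) \<le> ennreal B"
proof -
  have p: "real DIM('a) < p"
    by (rule critical_exponent_gt[OF \<open>0 < s\<close> \<open>s < 1\<close> \<open>s * p = real DIM('a)\<close>]) simp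
  then have p1: "1 \<le> p" and p0: "0 < p" using DIM_positive[where 'a='a] by linarith+
  obtain C where C: "0 \<le> C" "\<And>l x::'a. 0 < l \<Longrightarrow>
    (\<integral>\<^sup>+y. ennreal (min 2 (l * norm (x - y)) powr p / norm (x - y) powr (2 * real DIM('a))) \<partial>lborel)
      \<le> ennreal (C * l ^ DIM('a))"
    using truncated_kernel_integral_bound[OF p] by blast
  define V where "V = measure lborel \<Omega>"
  have V: "emeasure lborel \<Omega> \<le> ennreal V" "0 \<le> V"
    using emeasure_bounded_finite[OF \<open>bounded \<Omega>\<close>] by (auto simp: V_def emeasure_eq_ennreal_measure)
  define m where "m = 2 * V * C"
  let ?A = "(1 powr p * V) powr (1 / p)" and ?B = "(gagliardo_const DIM('a) s p * m) powr (1 / p)"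
  have "osc e s l \<in> sobolev_space \<Omega> s (ereal p) \<and>
     sobolev_norm \<Omega> s (ereal p) (osc e s l) \<le> ennreal ((?B powr p + ?A powr p) powr (1 / p))"
    if l: "1 \<le> l" for l
  proof (rule sobolev_space_bounded)
    show "Lp_norm \<Omega> p (osc e s l) \<le> ennreal ?A"
      using assms V p0 l abs_osc_le[OF l, of s e] by (intro Lp_norm_le[where D = \<Omega>]) auto
    have "(\<integral>\<^sup>+x. (\<integral>\<^sup>+y. ennreal (\<bar>osc e s l x - osc e s l y\<bar> powr p / norm (x - y) powr (2 * real DIM('a)))
            \<partial>lebesgue_on \<Omega>) \<partial>lebesgue_on \<Omega>)
      \<le> ennreal (2 * V * (l powr (- s)) powr p * C * l ^ DIM('a))"
      using assms V C l p0 by (intro gagliardo_integral_bound[where D = \<Omega>] osc_increment) auto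
    \<comment> \<open>Exact cancellation at the critical exponent: the amplitude contributes l^(-s
      p), the kernel l^N.\<close>
    also have "2 * V * (l powr (- s)) powr p * C * l ^ DIM('a) = m"
    proof -
      have "(l powr (- s)) powr p * l ^ DIM('a) = l powr (- (s * p)) * l powr (s * p)"
        using l assms(6) by (simp add: powr_powr powr_realpow)
      also have "\<dots> = 1" using l by (simp add: powr_add[symmetric])
      finally have "(l powr (- s)) powr p * l ^ DIM('a) = 1" .
      then have "2 * V * C * ((l powr (- s)) powr p * l ^ DIM('a)) = m" by (simp add: m_def)
      then show ?thesis by (simp only: mult_ac)
    qed
    finally show "sobolev_seminorm \<Omega> s p (osc e s l) \<le> ennreal ?B"
      using assms p1 V C by (intro sobolev_seminorm_fractional_le) (auto simp: m_def)
    show "osc e s l \<in> borel_measurable (lebesgue_on \<Omega>)"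
      by (intro continuous_borel_measurable_lebesgue_on continuous_osc)
  qed (use assms p0 in auto)
  then show ?thesis by blast
qed

text \<open>Scale invariance: the supporting ball has volume of order l^(-N), and the kernel
  estimate at Lipschitz constant 4 l gives (4 l)^N. Only 4^N survives.\<close>

lemma bump_fractional_bounded:
  fixes \<Omega> :: "'a::euclidean_space set"
  assumes "open \<Omega>" "0 < s" "s < 1" "s * p = real DIM('a)"
  shows "\<exists>B. \<forall>l\<ge>1. bump x0 l \<in> sobolev_space \<Omega> s (ereal p) \<and>
     sobolev_norm \<Omega> s (ereal p) (bump x0 l) \<le> ennreal B"
proof -
  have p: "real DIM('a) < p"
    by (rule critical_exponent_gt[OF \<open>0 < s\<close> \<open>s < 1\<close> \<open>s * p = real DIM('a)\<close>]) simp
  then have p1: "1 \<le> p" and p0: "0 < p" using DIM_positive[where 'a='a] by linarith+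
  obtain C where C: "0 \<le> C" "\<And>l x::'a. 0 < l \<Longrightarrow>
    (\<integral>\<^sup>+y. ennreal (min 2 (l * norm (x - y)) powr p / norm (x - y) powr (2 * real DIM('a))) \<partial>lborel)
      \<le> ennreal (C * l ^ DIM('a))"
    using truncated_kernel_integral_bound[OF p] by blast
  define V where "V = unit_ball_vol DIM('a)"
  have V: "0 \<le> V" by (simp add: V_def)
  define m where "m = 2 * V * C * 4 ^ DIM('a)"
  let ?A = "(1 powr p * V) powr (1 / p)" and ?B = "(gagliardo_const DIM('a) s p * m) powr (1 / p)"
  have "bump x0 l \<in> sobolev_space \<Omega> s (ereal p) \<and>
     sobolev_norm \<Omega> s (ereal p) (bump x0 l) \<le> ennreal ((?B powr p + ?A powr p) powr (1 / p))"
    if l: "1 \<le> l" for l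
  proof (rule sobolev_space_bounded)
    have vol: "emeasure lborel (ball x0 (1 / l)) = ennreal (V * (1 / l) ^ DIM('a))"
      using l by (simp add: emeasure_ball V_def)
    have "(1 / l) ^ DIM('a) \<le> 1" using l by (intro power_le_one) auto
    then have "V * (1 / l) ^ DIM('a) \<le> V" using V by (metis mult.right_neutral mult_left_mono)
    then have vol1: "emeasure lborel (ball x0 (1 / l)) \<le> ennreal V"
      unfolding vol by (rule ennreal_leI)
    show "Lp_norm \<Omega> p (bump x0 l) \<le> ennreal ?A"
      using assms V p0 l vol1 bump_bounds[of x0 l] bump_outside[of l _ x0]
      by (intro Lp_norm_le[where D = "ball x0 (1 / l)"]) (auto simp: indicator_def)
    have "(\<integral>\<^sup>+x. (\<integral>\<^sup>+y. ennreal (\<bar>bump x0 l x - bump x0 l y\<bar> powr p / norm (x - y) powr (2 * real DIM('a)))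
            \<partial>lebesgue_on \<Omega>) \<partial>lebesgue_on \<Omega>)
      \<le> ennreal (2 * (V * (1 / l) ^ DIM('a)) * 1 powr p * C * (4 * l) ^ DIM('a))"
      using assms V C(1) l p0 vol bump_outside[of l _ x0]
      by (intro gagliardo_integral_bound[where D = "ball x0 (1 / l)"] bump_increment C(2)) auto
    also have "2 * (V * (1 / l) ^ DIM('a)) * 1 powr p * C * (4 * l) ^ DIM('a) = m"
      using l by (simp add: m_def field_simps)
    finally show "sobolev_seminorm \<Omega> s p (bump x0 l) \<le> ennreal ?B"
      using assms p1 V C by (intro sobolev_seminorm_fractional_le) (auto simp: m_def)
    show "bump x0 l \<in> borel_measurable (lebesgue_on \<Omega>)"
      by (intro continuous_borel_measurable_lebesgue_on continuous_bump)
  qed (use assms p0 in auto)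
  then show ?thesis by blast
qed

text \<open>Take x near the centre, where the bump is at least 1/2, and z just outside the support,
  at mutual distance at most 4/l. The two balls contribute l^(-2 N) and the kernel l^(N + t q), so
  the bound carries the power t q - N, which is nonnegative by hypothesis. The threshold 2/d keeps
  all these points in \<Omega>.\<close>

lemma bump_fractional_lower:
  fixes \<Omega> :: "'a::euclidean_space set"
  assumes "open \<Omega>" "x0 \<in> \<Omega>" "0 < t" "t < 1" "1 \<le> q" "real DIM('a) \<le> t * q"
  shows "\<exists>c>0. \<exists>l0\<ge>1. \<forall>l\<ge>l0. \<forall>w. (AE x in lebesgue_on \<Omega>. w x = bump x0 l x) \<longrightarrow>
    c \<le> sobolev_seminorm \<Omega> t q w"
proof -
  obtain d where d: "0 < d" "ball x0 d \<subseteq> \<Omega>" using assms by (meson openE)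
  obtain e :: 'a where e: "norm e = 1" using vector_choose_size[of 1] by auto
  let ?N = "DIM('a)" and ?v = "unit_ball_vol DIM('a)"
  define a where "a = real ?N + t * q"
  \<comment> \<open>The value of the lower bound below at \<open>l = 1\<close>; 1/8 is the product
    of the radii 1/4 and 1/2.\<close>
  define m where "m = ?v * ?v * (1 / 8) ^ ?N * ((1 / 2) powr q / 4 powr a)"
  have m: "0 < m" by (auto simp: m_def)
  let ?c = "ennreal ((gagliardo_const ?N t q * m) powr (1 / q))"
  have "0 < gagliardo_const ?N t q" using assms by (intro gagliardo_const_pos) (auto simp: Suc_le_eq)
  then have "0 < ?c" using m by simp
  moreover have "?c \<le> sobolev_seminorm \<Omega> t q w"
    if l: "max 1 (2 / d) \<le> l" and w: "AE x in lebesgue_on \<Omega>. w x = bump x0 l x" for l w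
  proof -
    have l1: "1 \<le> l" "2 / l \<le> d" using l d by (auto simp: field_simps)
    have "ennreal (?v * (1 / (4 * l)) ^ ?N * (?v * (1 / (2 * l)) ^ ?N) * ((1 / 2) powr q / (4 / l) powr a))
       \<le> (\<integral>\<^sup>+x. (\<integral>\<^sup>+y. ennreal (\<bar>w x - w y\<bar> powr q / norm (x - y) powr a) \<partial>lebesgue_on \<Omega>) \<partial>lebesgue_on \<Omega>)"
    proof (rule gagliardo_integral_lower[OF \<open>open \<Omega>\<close> _ _ _ _ _ _ _ _ w])
      have "1 / (4 * l) \<le> d" using l1 by (simp add: field_simps)
      then show "ball x0 (1 / (4 * l)) \<subseteq> \<Omega>" using d(2) subset_ball by blast
      fix x assume "x \<in> ball x0 (1 / (4 * l))"
      then have x: "norm (x - x0) < 1 / (4 * l)" by (simp add: dist_norm norm_minus_commute)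
      have "l * norm (x - x0) \<le> 1 / 4" using x l1 by (simp add: field_simps)
      then have "(l * norm (x - x0))\<^sup>2 \<le> (1 / 4)\<^sup>2" using l1 by (intro power_mono) auto
      then have "15 / 16 \<le> max 0 (1 - (l * norm (x - x0))\<^sup>2)" by (simp add: power2_eq_square)
      then have "(15 / 16)\<^sup>2 \<le> bump x0 l x" unfolding bump_def by (rule power_mono) simp
      then have bx: "1 / 2 \<le> bump x0 l x" by (simp add: power2_eq_square)
      show "\<exists>y. ball y (1 / (2 * l)) \<subseteq> \<Omega> \<and>
          (\<forall>z\<in>ball y (1 / (2 * l)). 1 / 2 \<le> \<bar>bump x0 l x - bump x0 l z\<bar> \<and> norm (x - z) \<le> 4 / l)"
      proof (intro exI[of _ "x0 + (3 / (2 * l)) *\<^sub>R e"])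
        \<comment> \<open>The centre at distance 3/(2 l) and the radius 1/(2 l) let the ball span
          the full width of the annulus between 1/l and 2/l, where the bump vanishes.\<close>
        have z: "1 / l \<le> norm (z - x0) \<and> norm (z - x0) < 2 / l"
          if "z \<in> ball (x0 + (3 / (2 * l)) *\<^sub>R e) (1 / (2 * l))" for z
        proof -
          have y: "norm ((3 / (2 * l)) *\<^sub>R e) = 3 / (2 * l)" using e l1 by simp
          have zy: "norm ((z - x0) - (3 / (2 * l)) *\<^sub>R e) < 1 / (2 * l)"
            using that by (simp add: dist_norm norm_minus_commute algebra_simps)
          have *: "3 / (2 * l) - 1 / (2 * l) = 1 / l" "3 / (2 * l) + 1 / (2 * l) = 2 / l"
            using l1 by (auto simp: field_simps)
          show ?thesis
            using norm_triangle_ineq2[of "(3 / (2 * l)) *\<^sub>R e" "z - x0"]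
              norm_triangle_ineq2[of "z - x0" "(3 / (2 * l)) *\<^sub>R e"] zy y *
            by (simp add: norm_minus_commute)
        qed
        have "z \<in> ball x0 d" if "z \<in> ball (x0 + (3 / (2 * l)) *\<^sub>R e) (1 / (2 * l))" for z
          using z[OF that] l1 by (simp add: dist_norm norm_minus_commute)
        then have "ball (x0 + (3 / (2 * l)) *\<^sub>R e) (1 / (2 * l)) \<subseteq> \<Omega>" using d(2) by blast
        moreover have "1 / 2 \<le> \<bar>bump x0 l x - bump x0 l z\<bar> \<and> norm (x - z) \<le> 4 / l"
          if "z \<in> ball (x0 + (3 / (2 * l)) *\<^sub>R e) (1 / (2 * l))" for z
        proof
          have "bump x0 l z = 0"
            using z[OF that] l1 by (intro bump_outside) (auto simp: dist_norm norm_minus_commute)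
          then show "1 / 2 \<le> \<bar>bump x0 l x - bump x0 l z\<bar>" using bx by simp
          have "norm (x - z) \<le> norm (x - x0) + norm (z - x0)"
            using norm_triangle_ineq4[of "x - x0" "z - x0"] by simp
          also have "\<dots> \<le> 1 / (4 * l) + 2 / l" using x z[OF that] by linarith
          also have "\<dots> \<le> 4 / l" using l1 by (simp add: field_simps)
          finally show "norm (x - z) \<le> 4 / l" .
        qed
        ultimately show "ball (x0 + (3 / (2 * l)) *\<^sub>R e) (1 / (2 * l)) \<subseteq> \<Omega> \<and>
          (\<forall>z\<in>ball (x0 + (3 / (2 * l)) *\<^sub>R e) (1 / (2 * l)).
             1 / 2 \<le> \<bar>bump x0 l x - bump x0 l z\<bar> \<and> norm (x - z) \<le> 4 / l)" by blast
      qed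
    qed (use assms l1 in \<open>auto simp: a_def\<close>)
    moreover have "m \<le> ?v * (1 / (4 * l)) ^ ?N * (?v * (1 / (2 * l)) ^ ?N) * ((1 / 2) powr q / (4 / l) powr a)"
    proof -
      have "(1 / (4 * l)) ^ ?N * (1 / (2 * l)) ^ ?N = ((1 / 8) * (1 / (l * l))) ^ ?N"
        by (simp add: power_mult_distrib[symmetric])
      also have "\<dots> = (1 / 8) ^ ?N * (1 / (l ^ ?N * l ^ ?N))"
        by (simp add: power_mult_distrib power_divide)
      also have "l ^ ?N * l ^ ?N = l powr (2 * real ?N)"
        using l1 by (simp add: powr_realpow[symmetric] powr_add[symmetric])
      finally have 1: "(1 / (4 * l)) ^ ?N * (1 / (2 * l)) ^ ?N = (1 / 8) ^ ?N * (1 / l powr (2 * real ?N))" .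
      have 2: "(1 / 2) powr q / (4 / l) powr a = (1 / 2) powr q / 4 powr a * l powr a"
        using l1 by (simp add: powr_divide)
      have "l powr (2 * real ?N) \<le> l powr a" using l1 assms by (intro powr_mono) (auto simp: a_def)
      then have 3: "1 \<le> 1 / l powr (2 * real ?N) * l powr a" using l1 by (simp add: field_simps)
      have "m * 1 \<le> m * (1 / l powr (2 * real ?N) * l powr a)"
        using m 3 by (intro mult_left_mono) auto
      also have "\<dots> = ?v * ?v * ((1 / 8) ^ ?N * (1 / l powr (2 * real ?N))) * ((1 / 2) powr q / 4 powr a * l powr a)"
        unfolding m_def by (simp only: mult_ac)
      also have "\<dots> = ?v * (1 / (4 * l)) ^ ?N * (?v * (1 / (2 * l)) ^ ?N) * ((1 / 2) powr q / (4 / l) powr a)"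
        unfolding 1[symmetric] 2[symmetric] by (simp only: mult_ac)
      finally show ?thesis by simp
    qed
    ultimately have "ennreal m \<le> (\<integral>\<^sup>+x. (\<integral>\<^sup>+y. ennreal (\<bar>w x - w y\<bar> powr q / norm (x - y) powr a)
        \<partial>lebesgue_on \<Omega>) \<partial>lebesgue_on \<Omega>)"
      using ennreal_leI order_trans by blast
    then show ?thesis unfolding a_def using assms m by (intro sobolev_seminorm_fractional_ge) auto
  qed
  moreover have "1 \<le> max 1 (2 / d)" by simp
  ultimately show ?thesis by blast
qed

lemma sin_shift_eq_1:
  fixes x :: real
  shows "\<exists>t. 0 \<le> t \<and> t \<le> 2 * pi \<and> sin (x + t) = 1"
proof -
  define k where "k = \<lceil>(x - pi / 2) / (2 * pi)\<rceil>"
  have k: "(x - pi / 2) / (2 * pi) \<le> real_of_int k" "real_of_int k < (x - pi / 2) / (2 * pi) + 1"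
    unfolding k_def by linarith+
  have "x - pi / 2 \<le> 2 * pi * real_of_int k" "2 * pi * real_of_int k < x - pi / 2 + 2 * pi"
    using k pi_gt_zero by (auto simp: field_simps)
  moreover have "sin (x + (pi / 2 + 2 * pi * real_of_int k - x)) = 1"
    using cos_int_2pin[of k] by (simp add: sin_add mult_ac)
  ultimately show ?thesis by (intro exI[of _ "pi / 2 + 2 * pi * real_of_int k - x"]) auto
qed

text \<open>From a nonpositive value move forward to a maximum of the sine. From a positive one move
  to a minimum, found as a maximum of the sine shifted by \<open>pi\<close>.\<close>

lemma sin_shift_far:
  fixes x :: real
  shows "\<exists>t. 0 \<le> t \<and> t \<le> 2 * pi \<and> 1 \<le> \<bar>sin x - sin (x + t)\<bar>"
proof (cases "sin x \<le> 0")
  case True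
  then show ?thesis using sin_shift_eq_1[of x] by force
next
  case False
  obtain t where "0 \<le> t" "t \<le> 2 * pi" "sin ((x + pi) + t) = 1" using sin_shift_eq_1 by blast
  moreover have "sin ((x + pi) + t) = - sin (x + t)" using sin_periodic_pi[of "x + t"] by (simp add: ac_simps)
  ultimately show ?thesis using False by (intro exI[of _ t]) auto
qed

text \<open>Oscillation takes place everywhere, so x runs over a ball of fixed radius and only the
  z-ball costs l^(-N). The powers -N, -s q and N + t q add up to (t - s) q, which is nonnegative
  whatever the relation between q and N.\<close>

lemma osc_fractional_lower:
  fixes \<Omega> :: "'a::euclidean_space set"
  assumes "open \<Omega>" "x0 \<in> \<Omega>" "norm e = 1" "0 < t" "t < 1" "1 \<le> q" "s \<le> t"
  shows "\<exists>c>0. \<exists>l0\<ge>1. \<forall>l\<ge>l0. \<forall>w. (AE x in lebesgue_on \<Omega>. w x = osc e s l x) \<longrightarrow>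
    c \<le> sobolev_seminorm \<Omega> t q w"
proof -
  obtain d where d: "0 < d" "ball x0 d \<subseteq> \<Omega>" using assms by (meson openE)
  let ?N = "DIM('a)" and ?v = "unit_ball_vol DIM('a)"
  define a where "a = real ?N + t * q"
  \<comment> \<open>A phase shift of at most 2 pi < 7 moves by at most 7/l, and the z-ball of radius
    1/(2 l) stays within 8/l of x. Over that radius the sine changes by at most 1/2, so half of the
    gap 1 remains.\<close>
  define m where "m = ?v * (d / 2) ^ ?N * (?v * (1 / 2) ^ ?N) * ((1 / 2) powr q / 8 powr a)"
  have m: "0 < m" using d by (auto simp: m_def)
  let ?c = "ennreal ((gagliardo_const ?N t q * m) powr (1 / q))"
  have "0 < gagliardo_const ?N t q" using assms by (intro gagliardo_const_pos) (auto simp: Suc_le_eq)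
  then have "0 < ?c" using m by simp
  moreover have "?c \<le> sobolev_seminorm \<Omega> t q w"
    if l: "max 1 (16 / d) \<le> l" and w: "AE x in lebesgue_on \<Omega>. w x = osc e s l x" for l w
  proof -
    have l1: "1 \<le> l" "8 / l \<le> d / 2" using l d by (auto simp: field_simps)
    have "ennreal (?v * (d / 2) ^ ?N * (?v * (1 / (2 * l)) ^ ?N) * ((l powr (- s) * (1 / 2)) powr q / (8 / l) powr a))
       \<le> (\<integral>\<^sup>+x. (\<integral>\<^sup>+y. ennreal (\<bar>w x - w y\<bar> powr q / norm (x - y) powr a) \<partial>lebesgue_on \<Omega>) \<partial>lebesgue_on \<Omega>)"
    proof (rule gagliardo_integral_lower[OF \<open>open \<Omega>\<close> _ _ _ _ _ _ _ _ w])
      show "ball x0 (d / 2) \<subseteq> \<Omega>" using d subset_ball[of "d / 2" d x0] by auto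
      fix x assume "x \<in> ball x0 (d / 2)"
      then have x: "norm (x - x0) < d / 2" by (simp add: dist_norm norm_minus_commute)
      obtain \<tau> where \<tau>: "0 \<le> \<tau>" "\<tau> \<le> 2 * pi" "1 \<le> \<bar>sin (l * (x \<bullet> e)) - sin (l * (x \<bullet> e) + \<tau>)\<bar>"
        using sin_shift_far by blast
      \<comment> \<open>Moving along \<open>e\<close> by \<open>\<tau> / l\<close> advances the
        phase by exactly \<open>\<tau>\<close>.\<close>
      define y where "y = x + (\<tau> / l) *\<^sub>R e"
      have "e \<bullet> e = 1" using assms(3) by (simp add: norm_eq_1)
      then have ye: "l * (y \<bullet> e) = l * (x \<bullet> e) + \<tau>"
        using l1 by (simp add: y_def inner_add_left algebra_simps)
      have z: "norm (x - z) \<le> 8 / l \<and> 1 / 2 \<le> \<bar>sin (l * (x \<bullet> e)) - sin (l * (z \<bullet> e))\<bar>"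
        if "z \<in> ball y (1 / (2 * l))" for z
      proof
        have yz: "norm (y - z) < 1 / (2 * l)" using that by (simp add: dist_norm)
        have "norm (x - z) \<le> norm (x - y) + norm (y - z)" by (metis diff_add_cancel norm_triangle_ineq add_diff_eq)
        also have "norm (x - y) = \<tau> / l" using \<tau> l1 assms(3) by (simp add: y_def)
        also have "\<tau> / l \<le> 7 / l" using \<tau> l1 pi_less_4 pi_approx by (intro divide_right_mono) auto
        finally have "norm (x - z) \<le> 7 / l + 1 / (2 * l)" using yz by simp
        also have "\<dots> \<le> 8 / l" using l1 by (simp add: field_simps)
        finally show "norm (x - z) \<le> 8 / l" .
        have "\<bar>sin (l * (y \<bullet> e)) - sin (l * (z \<bullet> e))\<bar> \<le> l * norm (y - z)"
          using l1 assms(3) by (intro abs_sin_inner_diff_le) auto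
        also have "\<dots> \<le> 1 / 2" using yz l1 by (simp add: field_simps)
        finally show "1 / 2 \<le> \<bar>sin (l * (x \<bullet> e)) - sin (l * (z \<bullet> e))\<bar>" using \<tau>(3) unfolding ye by linarith
      qed
      have "z \<in> ball x0 d" if "z \<in> ball y (1 / (2 * l))" for z
      proof -
        have "norm (z - x0) \<le> norm (x - z) + norm (x - x0)"
          using norm_triangle_ineq4[of "x - x0" "x - z"] by simp
        then show ?thesis using z[OF that] x l1 by (simp add: dist_norm norm_minus_commute)
      qed
      then have "ball y (1 / (2 * l)) \<subseteq> \<Omega>" using d by blast
      moreover have "l powr (- s) * (1 / 2) \<le> \<bar>osc e s l x - osc e s l z\<bar>" if "z \<in> ball y (1 / (2 * l))" for z
        using z[OF that] mult_left_mono[of "1 / 2" "\<bar>sin (l * (x \<bullet> e)) - sin (l * (z \<bullet> e))\<bar>" "l powr (- s)"]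
        by (simp add: osc_def right_diff_distrib[symmetric] abs_mult)
      ultimately show "\<exists>y. ball y (1 / (2 * l)) \<subseteq> \<Omega> \<and>
          (\<forall>z\<in>ball y (1 / (2 * l)). l powr (- s) * (1 / 2) \<le> \<bar>osc e s l x - osc e s l z\<bar> \<and> norm (x - z) \<le> 8 / l)"
        using z by blast
    qed (use assms l1 d in \<open>auto simp: a_def\<close>)
    moreover have "m \<le> ?v * (d / 2) ^ ?N * (?v * (1 / (2 * l)) ^ ?N) * ((l powr (- s) * (1 / 2)) powr q / (8 / l) powr a)"
    proof -
      have 1: "(1 / (2 * l)) ^ ?N = (1 / 2) ^ ?N * l powr (- real ?N)"
        using l1 by (simp add: powr_minus powr_realpow power_mult_distrib power_divide divide_simps)
      have 2: "(l powr (- s) * (1 / 2)) powr q / (8 / l) powr a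
          = (1 / 2) powr q / 8 powr a * (l powr (- s * q) * l powr a)"
        using l1 by (simp add: powr_divide powr_mult powr_powr)
      have "s * q \<le> t * q" using assms by (intro mult_right_mono) auto
      then have "1 \<le> l powr (- real ?N + (- s * q + a))" using l1 by (intro ge_one_powr_ge_zero) (auto simp: a_def)
      then have "1 \<le> l powr (- real ?N) * (l powr (- s * q) * l powr a)" by (simp only: powr_add)
      then have "m * 1 \<le> m * (l powr (- real ?N) * (l powr (- s * q) * l powr a))"
        using m by (intro mult_left_mono) auto
      also have "\<dots> = ?v * (d / 2) ^ ?N * (?v * (1 / (2 * l)) ^ ?N) * ((l powr (- s) * (1 / 2)) powr q / (8 / l) powr a)"
        unfolding 1 2 m_def by (simp only: mult_ac)
      finally show ?thesis by simp
    qed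
    ultimately have "ennreal m \<le> (\<integral>\<^sup>+x. (\<integral>\<^sup>+y. ennreal (\<bar>w x - w y\<bar> powr q / norm (x - y) powr a)
        \<partial>lebesgue_on \<Omega>) \<partial>lebesgue_on \<Omega>)"
      using ennreal_leI order_trans by blast
    then show ?thesis unfolding a_def using assms m by (intro sobolev_seminorm_fractional_ge) auto
  qed
  moreover have "1 \<le> max 1 (16 / d)" by simp
  ultimately show ?thesis by blast
qed

subsection \<open>Weak gradients and smooth cut-offs\<close>

lemma integrable_compact_support:
  fixes f :: "'a::euclidean_space \<Rightarrow> 'b::euclidean_space"
  assumes "continuous_on UNIV f" "compact K" "\<And>x. x \<notin> K \<Longrightarrow> f x = 0"
  shows "integrable lborel f"
proof -
  have "integrable lborel (\<lambda>x. indicator K x *\<^sub>R f x)"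
    using assms(1,2) by (intro borel_integrable_compact) (auto intro: continuous_on_subset)
  moreover have "(\<lambda>x. indicator K x *\<^sub>R f x) = f"
    using assms(3) by (auto simp: indicator_def)
  ultimately show ?thesis by simp
qed

lemma integral_lborel_translate:
  fixes f :: "'a::euclidean_space \<Rightarrow> real"
  assumes "continuous_on UNIV f"
  shows "(LINT x|lborel. f (x + b)) = (LINT x|lborel. f x)"
proof -
  have [measurable]: "f \<in> borel_measurable borel" using assms by (rule borel_measurable_continuous_onI)
  have "(LINT x|lborel. f x) = (LINT x|distr lborel borel ((+) b). f x)"
    by (simp add: lborel_distr_plus)
  also have "\<dots> = (LINT x|lborel. f (b + x))" by (rule integral_distr) simp_all
  finally show ?thesis by (simp add: add.commute)
qed

text \<open>Translation invariance kills the integral of each difference quotient of \<open>F\<close>.\<close>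

lemma integral_directional_derivative_eq_0:
  fixes F G :: "'a::euclidean_space \<Rightarrow> real"
  assumes der: "\<And>x. ((\<lambda>t. F (x + t *\<^sub>R b)) has_real_derivative G x) (at 0)"
    and F: "continuous_on UNIV F" and G: "continuous_on UNIV G"
    and K: "compact K" "\<And>x. x \<notin> K \<Longrightarrow> F x = 0" "\<And>x. x \<notin> K \<Longrightarrow> G x = 0"
  shows "(LINT x|lborel. G x) = 0"
proof -
  have [measurable]: "F \<in> borel_measurable borel" "G \<in> borel_measurable borel"
    using F G by (auto intro: borel_measurable_continuous_onI)
  have "bounded (G ` K)"
    using G K(1) by (intro compact_imp_bounded compact_continuous_image) (auto intro: continuous_on_subset)
  then obtain M where M: "0 < M" "\<And>x. x \<in> K \<Longrightarrow> \<bar>G x\<bar> \<le> M" by (auto simp: bounded_pos)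
  then have GM: "\<bar>G x\<bar> \<le> M" for x using K(3) by (cases "x \<in> K") auto
  obtain R where R: "\<And>x. x \<in> K \<Longrightarrow> norm x \<le> R"
    using K(1) compact_imp_bounded bounded_iff by metis
  have der': "((\<lambda>t. F (x + t *\<^sub>R b)) has_real_derivative G (x + t *\<^sub>R b)) (at t)" for x t
  proof -
    have "((\<lambda>h. F ((x + t *\<^sub>R b) + h *\<^sub>R b)) has_real_derivative G (x + t *\<^sub>R b)) (at 0)"
      by (rule der)
    then have "((\<lambda>h. F (x + (h + t) *\<^sub>R b)) has_real_derivative G (x + t *\<^sub>R b)) (at 0)"
      by (simp add: algebra_simps)
    then show ?thesis
      using DERIV_shift[of "\<lambda>t. F (x + t *\<^sub>R b)" "G (x + t *\<^sub>R b)" 0 t] by simp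
  qed
  define h :: "nat \<Rightarrow> real" where "h n = inverse (real (Suc n))" for n
  have h: "0 < h n" "h n \<le> 1" for n by (auto simp: h_def field_simps)
  define g where "g n x = (F (x + h n *\<^sub>R b) - F x) / h n" for n x
  \<comment> \<open>By the mean value theorem each difference quotient is a value of
    \<open>G\<close>, hence bounded by \<open>M\<close>. Since \<open>h n \<le> 1\<close>, all
    quotients vanish outside one common ball, so the dominating function is integrable.\<close>
  have bound: "\<bar>g n x\<bar> \<le> M" for n x
  proof -
    have "\<exists>z. 0 < z \<and> z < h n \<and> F (x + h n *\<^sub>R b) - F (x + 0 *\<^sub>R b) = (h n - 0) * G (x + z *\<^sub>R b)"
      using h der' by (intro MVT2) auto
    then obtain z where "F (x + h n *\<^sub>R b) - F x = h n * G (x + z *\<^sub>R b)" by auto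
    then have "g n x = G (x + z *\<^sub>R b)" using h[of n] by (simp add: g_def)
    then show ?thesis using GM by simp
  qed
  have support: "g n x = 0" if "x \<notin> cball 0 (R + norm b)" for n x
  proof -
    have x: "R + norm b < norm x" using that by simp
    have "norm (h n *\<^sub>R b) \<le> norm b" using h[of n] by (simp add: mult_left_le_one_le)
    then have "R < norm (x + h n *\<^sub>R b)" using x norm_triangle_ineq2[of x "- (h n *\<^sub>R b)"] by simp
    moreover have "R < norm x" using x norm_ge_zero[of b] by linarith
    ultimately have "x \<notin> K" "x + h n *\<^sub>R b \<notin> K" using R by (meson not_le)+
    then show ?thesis using K(2) by (simp add: g_def)
  qed
  have int_w: "integrable lborel (\<lambda>x::'a. M * indicator (cball 0 (R + norm b)) x)"
    by (intro integrable_mult_right integrable_real_indicator)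
       (simp_all add: emeasure_bounded_finite[unfolded infinity_ennreal_def])
  have Fi: "integrable lborel F" by (rule integrable_compact_support[OF F K(1,2)])
  have "(\<lambda>n. LINT x|lborel. g n x) \<longlonglongrightarrow> (LINT x|lborel. G x)"
  proof (rule integral_dominated_convergence[OF _ _ int_w])
    show "AE x in lborel. (\<lambda>n. g n x) \<longlonglongrightarrow> G x"
    proof (rule AE_I2)
      fix x
      have "((\<lambda>t. (F (x + t *\<^sub>R b) - F x) / t) \<longlongrightarrow> G x) (at 0)"
        using der[of x] by (simp add: has_field_derivative_iff)
      moreover have "filterlim h (at 0) sequentially"
        unfolding filterlim_at h_def using LIMSEQ_inverse_real_of_nat by auto
      ultimately show "(\<lambda>n. g n x) \<longlonglongrightarrow> G x"
        unfolding g_def by (rule filterlim_compose)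
    qed
    show "AE x in lborel. norm (g n x) \<le> M * indicator (cball 0 (R + norm b)) x" for n
      using bound support by (intro AE_I2) (auto simp: indicator_def)
    show "g n \<in> borel_measurable lborel" for n unfolding g_def by measurable
  qed simp
  moreover have "(LINT x|lborel. g n x) = 0" for n
  proof -
    have "integrable lborel (\<lambda>x. F (x + h n *\<^sub>R b))"
    proof (rule integrable_compact_support)
      show "continuous_on UNIV (\<lambda>x. F (x + h n *\<^sub>R b))"
        by (intro continuous_on_compose2[OF F] continuous_intros) auto
      show "compact ((\<lambda>x. - (h n *\<^sub>R b) + x) ` K)" using K(1) by (rule compact_translation)
      show "F (x + h n *\<^sub>R b) = 0" if "x \<notin> (\<lambda>x. - (h n *\<^sub>R b) + x) ` K" for x
      proof (rule K(2), rule notI)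
        assume "x + h n *\<^sub>R b \<in> K"
        then have "- (h n *\<^sub>R b) + (x + h n *\<^sub>R b) \<in> (\<lambda>x. - (h n *\<^sub>R b) + x) ` K" by blast
        then show False using that by simp
      qed
    qed
    then show ?thesis unfolding g_def using Fi integral_lborel_translate[OF F, of "h n *\<^sub>R b"]
      by simp
  qed
  ultimately have "(\<lambda>n::nat. 0::real) \<longlonglongrightarrow> (LINT x|lborel. G x)" by simp
  then show ?thesis using LIMSEQ_unique tendsto_const by blast
qed

lemma set_integrable_lebesgue_continuous:
  fixes f :: "'a::euclidean_space \<Rightarrow> 'b::euclidean_space"
  assumes "continuous_on UNIV f" "compact K"
  shows "set_integrable lebesgue K f"
proof -
  have "integrable lborel (\<lambda>x. indicator K x *\<^sub>R f x)"
    using assms by (intro borel_integrable_compact) (auto intro: continuous_on_subset)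
  then show ?thesis unfolding set_integrable_def
    by (subst integrable_completion) (auto dest: borel_measurable_integrable)
qed

lemma integral_lebesgue_on_support:
  fixes f :: "'a::euclidean_space \<Rightarrow> real"
  assumes "open \<Omega>" "continuous_on UNIV f" "K \<subseteq> \<Omega>" "\<And>x. x \<notin> K \<Longrightarrow> f x = 0"
  shows "(LINT x|lebesgue_on \<Omega>. f x) = (LINT x|lborel. f x)"
proof -
  have "(LINT x|lebesgue_on \<Omega>. f x) = (LINT x|lebesgue. indicator \<Omega> x *\<^sub>R f x)"
    using assms(1) by (intro integral_restrict_space) auto
  also have "(\<lambda>x. indicator \<Omega> x *\<^sub>R f x) = f"
    using assms(3,4) by (force simp: indicator_def)
  also have "(LINT x|lebesgue. f x) = (LINT x|lborel. f x)"
    using borel_measurable_continuous_onI[OF assms(2)] by (intro integral_completion) simp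
  finally show ?thesis .
qed

lemma has_derivative_imp_directional:
  fixes f :: "'a::euclidean_space \<Rightarrow> real"
  assumes "(f has_derivative D) (at x)"
  shows "((\<lambda>t. f (x + t *\<^sub>R b)) has_real_derivative D b) (at 0)"
proof -
  have "((\<lambda>t. f (x + t *\<^sub>R b)) has_derivative (\<lambda>t. D (t *\<^sub>R b))) (at 0)"
    by (rule has_derivative_compose[where g = f and g' = D])
       (use assms in \<open>auto intro!: derivative_eq_intros\<close>)
  moreover have "(\<lambda>t. D (t *\<^sub>R b)) = (*) (D b)"
    using has_derivative_linear[OF assms] by (auto simp: linear_cmul)
  ultimately show ?thesis by (simp add: has_field_derivative_def)
qed

lemma frechet_derivative_eq_0_outside:
  fixes f :: "'a::euclidean_space \<Rightarrow> real"
  assumes "closed K" "\<And>x. x \<notin> K \<Longrightarrow> f x = 0" "x \<notin> K"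
  shows "frechet_derivative f (at x) b = 0"
proof -
  have "(f has_derivative (\<lambda>_. 0)) (at x)"
    by (rule has_derivative_transform_within_open[of "\<lambda>_. 0" _ _ _ "- K"])
       (use assms in auto)
  then show ?thesis using frechet_derivative_at by metis
qed

text \<open>The product u \<phi> inherits compact support from \<phi>, so the integral of its
  derivative along b vanishes; the product rule turns this into the defining identity.\<close>

lemma has_weak_gradient_continuous:
  fixes u :: "'a::euclidean_space \<Rightarrow> real"
  assumes "open \<Omega>" and v: "continuous_on UNIV v"
    and u: "\<And>x. (u has_derivative (\<lambda>h. v x \<bullet> h)) (at x)"
  shows "has_weak_gradient \<Omega> u v"
  unfolding has_weak_gradient_def
proof (intro conjI allI impI ballI)
  have uc: "continuous_on UNIV u"
    by (rule has_derivative_continuous_on) (rule u)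
  show "locally_integrable \<Omega> u" "locally_integrable \<Omega> v"
    using uc v by (auto simp: locally_integrable_def set_integrable_lebesgue_continuous)
  fix \<phi> :: "'a \<Rightarrow> real" and b :: 'a
  assume \<phi>: "test_function \<Omega> \<phi>" and b: "b \<in> Basis"
  then obtain K where K: "compact K" "K \<subseteq> \<Omega>" "\<And>x. x \<notin> K \<Longrightarrow> \<phi> x = 0"
    by (auto simp: test_function_def)
  have "Ck 1 \<phi>" using \<phi> unfolding test_function_def by blast
  let ?D = "\<lambda>x. frechet_derivative \<phi> (at x) b"
  have d\<phi>: "(\<phi> has_derivative frechet_derivative \<phi> (at x)) (at x)" for x
    using \<open>Ck 1 \<phi>\<close> by (simp add: frechet_derivative_works[symmetric])
  have Dc: "continuous_on UNIV ?D" using \<open>Ck 1 \<phi>\<close> b by simp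
  have \<phi>c: "continuous_on UNIV \<phi>"
    by (rule has_derivative_continuous_on) (rule d\<phi>)
  have D0: "?D x = 0" if "x \<notin> K" for x
    using K that by (intro frechet_derivative_eq_0_outside[of K]) (auto simp: compact_imp_closed)
  have c1: "continuous_on UNIV (\<lambda>x. u x * ?D x)" by (intro continuous_intros uc Dc)
  have c2: "continuous_on UNIV (\<lambda>x. (v x \<bullet> b) * \<phi> x)" by (intro continuous_intros v \<phi>c)
  have "(LINT x|lborel. u x * ?D x + (v x \<bullet> b) * \<phi> x) = 0"
  proof (rule integral_directional_derivative_eq_0[OF _ _ _ K(1), of "\<lambda>x. u x * \<phi> x"])
    show "((\<lambda>t. u (x + t *\<^sub>R b) * \<phi> (x + t *\<^sub>R b)) has_real_derivative u x * ?D x + (v x \<bullet> b) * \<phi> x) (at 0)" for x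
      using DERIV_mult[OF has_derivative_imp_directional[OF u] has_derivative_imp_directional[OF d\<phi>], of x b x b]
      by (simp add: algebra_simps)
  qed (use K D0 in \<open>auto intro!: continuous_intros uc Dc v \<phi>c\<close>)
  moreover have "integrable lborel (\<lambda>x. u x * ?D x)" "integrable lborel (\<lambda>x. (v x \<bullet> b) * \<phi> x)"
    using K D0 by (auto intro!: integrable_compact_support[OF c1 K(1)] integrable_compact_support[OF c2 K(1)])
  ultimately have "(LINT x|lborel. u x * ?D x) = - (LINT x|lborel. (v x \<bullet> b) * \<phi> x)" by simp
  moreover have "(LINT x|lebesgue_on \<Omega>. u x * ?D x) = (LINT x|lborel. u x * ?D x)"
    using D0 by (intro integral_lebesgue_on_support[OF \<open>open \<Omega>\<close> c1 K(2)]) auto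
  moreover have "(LINT x|lebesgue_on \<Omega>. (v x \<bullet> b) * \<phi> x) = (LINT x|lborel. (v x \<bullet> b) * \<phi> x)"
    using K(3) by (intro integral_lebesgue_on_support[OF \<open>open \<Omega>\<close> c2 K(2)]) auto
  ultimately show "(LINT x|lebesgue_on \<Omega>. u x * ?D x) = - (LINT x|lebesgue_on \<Omega>. (v x \<bullet> b) * \<phi> x)"
    by simp
qed

text \<open>The standard building block \<open>exp (- 1 / t)\<close> of smooth cut-offs, closed under derivatives
  thanks to the extra powers of \<open>t\<close>.\<close>

definition flat_exp :: "nat \<Rightarrow> real \<Rightarrow> real" where
  "flat_exp m t = (if 0 < t then exp (- inverse t) * inverse t ^ m else 0)"

lemma flat_exp_tendsto_0: "(flat_exp m \<longlongrightarrow> 0) (at 0)"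
proof -
  have "((\<lambda>t. inverse t ^ m / exp (inverse t)) \<longlongrightarrow> 0) (at_right (0::real))"
    by (rule filterlim_compose[OF tendsto_power_div_exp_0 filterlim_inverse_at_top_right])
  then have "(flat_exp m \<longlongrightarrow> 0) (at_right 0)"
    by (rule Lim_transform_eventually)
       (auto simp: eventually_at_filter flat_exp_def exp_minus field_simps)
  moreover have "(flat_exp m \<longlongrightarrow> 0) (at_left 0)"
    by (rule Lim_transform_eventually[OF tendsto_const]) (auto simp: eventually_at_filter flat_exp_def)
  ultimately show ?thesis by (simp add: filterlim_split_at_real)
qed

lemma flat_exp_has_derivative:
  "(flat_exp m has_real_derivative flat_exp (m + 2) t - real m * flat_exp (m + 1) t) (at t)"
proof -
  consider "0 < t" | "t < 0" | "t = 0" by linarith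
  then show ?thesis
  proof cases
    case 1
    have "((\<lambda>t. exp (- inverse t) * inverse t ^ m) has_real_derivative
        exp (- inverse t) * (inverse t)\<^sup>2 * inverse t ^ m
        + exp (- inverse t) * (real m * inverse t ^ (m - 1) * - (inverse t)\<^sup>2)) (at t)"
      using 1 by (auto intro!: derivative_eq_intros simp: power2_eq_square)
    also have "exp (- inverse t) * (inverse t)\<^sup>2 * inverse t ^ m
        + exp (- inverse t) * (real m * inverse t ^ (m - 1) * - (inverse t)\<^sup>2)
      = flat_exp (m + 2) t - real m * flat_exp (m + 1) t"
      using 1 by (cases m) (simp_all add: flat_exp_def power2_eq_square algebra_simps)
    finally show ?thesis
      by (rule has_field_derivative_transform_within_open[where S = "{0<..}"])
         (use 1 in \<open>auto simp: flat_exp_def\<close>)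
  next
    case 2
    have "((\<lambda>t. 0) has_real_derivative flat_exp (m + 2) t - real m * flat_exp (m + 1) t) (at t)"
      using 2 by (auto simp: flat_exp_def)
    then show ?thesis
      by (rule has_field_derivative_transform_within_open[where S = "{..<0}"])
         (use 2 in \<open>auto simp: flat_exp_def\<close>)
  next
    case 3
    \<comment> \<open>At the origin the difference quotient of one member of the family is the next
      member, whose limit is already known.\<close>
    have "(\<lambda>h. (flat_exp m (0 + h) - flat_exp m 0) / h) = flat_exp (m + 1)"
      by (auto simp: flat_exp_def field_simps fun_eq_iff)
    moreover have "flat_exp (m + 2) t - real m * flat_exp (m + 1) t = 0"
      using 3 by (simp add: flat_exp_def)
    ultimately show ?thesis using flat_exp_tendsto_0[of "m + 1"] 3
      by (simp only: DERIV_def)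
  qed
qed

text \<open>A class of functions that contains the test functions needed below and is closed under
  partial derivatives, so that all its members are smooth.\<close>

inductive smooth_class :: "'a::euclidean_space \<Rightarrow> real \<Rightarrow> real \<Rightarrow> 'a \<Rightarrow> ('a \<Rightarrow> real) \<Rightarrow> bool"
  for x0 r l e where
  const: "smooth_class x0 r l e (\<lambda>x. k)"
| linear: "smooth_class x0 r l e (\<lambda>x. x \<bullet> b)"
| sin: "smooth_class x0 r l e (\<lambda>x. sin (l * (x \<bullet> e)))"
| cos: "smooth_class x0 r l e (\<lambda>x. cos (l * (x \<bullet> e)))"
| flat: "smooth_class x0 r l e (\<lambda>x. flat_exp m (r - (x - x0) \<bullet> (x - x0)))"
| add: "smooth_class x0 r l e f \<Longrightarrow> smooth_class x0 r l e g \<Longrightarrow> smooth_class x0 r l e (\<lambda>x. f x + g x)"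
| mult: "smooth_class x0 r l e f \<Longrightarrow> smooth_class x0 r l e g \<Longrightarrow> smooth_class x0 r l e (\<lambda>x. f x * g x)"

lemma flat_cutoff_has_derivative:
  "((\<lambda>x. flat_exp m (r - (x - x0) \<bullet> (x - x0))) has_derivative
     (\<lambda>b. (flat_exp (m + 2) (r - (x - x0) \<bullet> (x - x0)) - real m * flat_exp (m + 1) (r - (x - x0) \<bullet> (x - x0)))
          * (- 2 * ((x - x0) \<bullet> b)))) (at x)"
proof -
  have "((\<lambda>x. r - (x - x0) \<bullet> (x - x0)) has_derivative (\<lambda>b. - 2 * ((x - x0) \<bullet> b))) (at x)"
    by (auto intro!: derivative_eq_intros simp: inner_commute)
  from has_derivative_compose[OF this flat_exp_has_derivative[unfolded has_field_derivative_def]]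
  show ?thesis .
qed

text \<open>One map D represents the derivative in all directions, and each slice with fixed
  direction stays in the class. This is the invariant behind smoothness of every order.\<close>

lemma smooth_class_derivative:
  assumes "smooth_class x0 r l e f"
  shows "\<exists>D. (\<forall>x. (f has_derivative D x) (at x)) \<and> (\<forall>b. smooth_class x0 r l e (\<lambda>x. D x b))"
  using assms
proof induction
  case (const k)
  then show ?case by (intro exI[of _ "\<lambda>x b. 0"]) (auto intro: smooth_class.const)
next
  case (linear c)
  show ?case
    by (intro exI[of _ "\<lambda>x b. b \<bullet> c"]) (auto intro!: smooth_class.const derivative_eq_intros)
next
  case sin
  have "((\<lambda>x. sin (l * (x \<bullet> e))) has_derivative (\<lambda>b. l * (b \<bullet> e) * cos (l * (x \<bullet> e)))) (at x)" for x
    by (auto intro!: derivative_eq_intros)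
  moreover have "smooth_class x0 r l e (\<lambda>x. l * (b \<bullet> e) * cos (l * (x \<bullet> e)))" for b
    by (intro smooth_class.mult[OF smooth_class.const smooth_class.cos])
  ultimately show ?case
    by (intro exI[of _ "\<lambda>x b. l * (b \<bullet> e) * cos (l * (x \<bullet> e))"] conjI allI)
next
  case cos
  have "((\<lambda>x. cos (l * (x \<bullet> e))) has_derivative (\<lambda>b. - (l * (b \<bullet> e)) * sin (l * (x \<bullet> e)))) (at x)" for x
    by (auto intro!: derivative_eq_intros)
  moreover have "smooth_class x0 r l e (\<lambda>x. - (l * (b \<bullet> e)) * sin (l * (x \<bullet> e)))" for b
    by (intro smooth_class.mult[OF smooth_class.const smooth_class.sin])
  ultimately show ?case
    by (intro exI[of _ "\<lambda>x b. - (l * (b \<bullet> e)) * sin (l * (x \<bullet> e))"] conjI allI)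
next
  case (flat m)
  \<comment> \<open>Subtraction is written as adding a constant multiple, and (x - x0) \<bullet> b
    as a linear function plus a constant, to fit the generators of the class.\<close>
  have "smooth_class x0 r l e
     (\<lambda>x. (flat_exp (m + 2) (r - (x - x0) \<bullet> (x - x0)) + (- real m) * flat_exp (m + 1) (r - (x - x0) \<bullet> (x - x0)))
          * (- 2 * (x \<bullet> b + - (x0 \<bullet> b))))" for b
    by (intro smooth_class.intros)
  moreover have "(flat_exp (m + 2) (r - (x - x0) \<bullet> (x - x0)) + (- real m) * flat_exp (m + 1) (r - (x - x0) \<bullet> (x - x0)))
          * (- 2 * (x \<bullet> b + - (x0 \<bullet> b)))
      = (flat_exp (m + 2) (r - (x - x0) \<bullet> (x - x0)) - real m * flat_exp (m + 1) (r - (x - x0) \<bullet> (x - x0)))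
          * (- 2 * ((x - x0) \<bullet> b))" for x b :: 'a
    by (simp add: inner_diff_left)
  ultimately show ?case
    by (intro exI[of _ "\<lambda>x b. (flat_exp (m + 2) (r - (x - x0) \<bullet> (x - x0))
          - real m * flat_exp (m + 1) (r - (x - x0) \<bullet> (x - x0))) * (- 2 * ((x - x0) \<bullet> b))"] conjI allI
          flat_cutoff_has_derivative) (simp only:)
next
  case (add f g)
  then obtain D E where "\<forall>x. (f has_derivative D x) (at x)" "\<forall>b. smooth_class x0 r l e (\<lambda>x. D x b)"
    "\<forall>x. (g has_derivative E x) (at x)" "\<forall>b. smooth_class x0 r l e (\<lambda>x. E x b)" by blast
  then show ?case
    by (intro exI[of _ "\<lambda>x b. D x b + E x b"]) (auto intro!: smooth_class.add has_derivative_add)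
next
  case (mult f g)
  then obtain D E where "\<forall>x. (f has_derivative D x) (at x)" "\<forall>b. smooth_class x0 r l e (\<lambda>x. D x b)"
    "\<forall>x. (g has_derivative E x) (at x)" "\<forall>b. smooth_class x0 r l e (\<lambda>x. E x b)" by blast
  with mult show ?case
    by (intro exI[of _ "\<lambda>x b. f x * E x b + D x b * g x"])
       (auto intro!: smooth_class.add smooth_class.mult has_derivative_mult)
qed

lemma smooth_class_Ck: "smooth_class x0 r l e f \<Longrightarrow> Ck k f"
proof (induction k arbitrary: f)
  case 0
  then obtain D where "\<And>x. (f has_derivative D x) (at x)"
    using smooth_class_derivative by blast
  then show ?case using has_derivative_continuous_on[of UNIV f D] by simp
next
  case (Suc k)
  obtain D where D: "\<And>x. (f has_derivative D x) (at x)" "\<And>b. smooth_class x0 r l e (\<lambda>x. D x b)"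
    using smooth_class_derivative[OF Suc.prems] by blast
  have "frechet_derivative f (at x) = D x" for x using frechet_derivative_at[OF D(1)] by simp
  then show ?case using D Suc.IH by (auto simp: differentiable_def)
qed

subsection \<open>Bumps and oscillations at order one\<close>

lemma sobolev_seminorm_1_le:
  assumes "open \<Omega>" "continuous_on UNIV v" "\<And>x. (u has_derivative (\<lambda>h. v x \<bullet> h)) (at x)"
  shows "sobolev_seminorm \<Omega> 1 p u \<le> Lp_norm \<Omega> p v"
  using has_weak_gradient_continuous[OF assms] by (auto simp: sobolev_seminorm_def intro: INF_lower)

lemma osc_gradient_bounded:
  fixes \<Omega> :: "'a::euclidean_space set"
  assumes "open \<Omega>" "bounded \<Omega>" "norm e = 1" "0 < p"
  shows "\<exists>B. \<forall>l\<ge>1. osc e 1 l \<in> sobolev_space \<Omega> 1 (ereal p) \<and>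
     sobolev_norm \<Omega> 1 (ereal p) (osc e 1 l) \<le> ennreal B"
proof -
  define V where "V = measure lborel \<Omega>"
  have V: "emeasure lborel \<Omega> \<le> ennreal V" "0 \<le> V"
    using emeasure_bounded_finite[OF \<open>bounded \<Omega>\<close>] by (auto simp: V_def emeasure_eq_ennreal_measure)
  let ?A = "(1 powr p * V) powr (1 / p)"
  have "osc e 1 l \<in> sobolev_space \<Omega> 1 (ereal p) \<and>
     sobolev_norm \<Omega> 1 (ereal p) (osc e 1 l) \<le> ennreal ((?A powr p + ?A powr p) powr (1 / p))"
    if l: "1 \<le> l" for l
  proof (rule sobolev_space_bounded)
    show "Lp_norm \<Omega> p (osc e 1 l) \<le> ennreal ?A"
      using assms V l abs_osc_le[OF l, of 1 e] by (intro Lp_norm_le[where D = \<Omega>]) auto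
    define v where "v x = cos (l * (x \<bullet> e)) *\<^sub>R e" for x
    have "sobolev_seminorm \<Omega> 1 p (osc e 1 l) \<le> Lp_norm \<Omega> p v"
    proof (rule sobolev_seminorm_1_le[OF \<open>open \<Omega>\<close>])
      show "continuous_on UNIV v" unfolding v_def by (intro continuous_intros)
      have l_cancel: "l powr - 1 * (l * c) = c" for c using l by (simp add: powr_minus)
      have "((\<lambda>x. sin (l * (x \<bullet> e))) has_derivative (\<lambda>h. l * (cos (l * (x \<bullet> e)) * (h \<bullet> e)))) (at x)" for x
        by (auto intro!: derivative_eq_intros)
      then have "(osc e 1 l has_derivative (\<lambda>h. l powr - 1 * (l * (cos (l * (x \<bullet> e)) * (h \<bullet> e))))) (at x)" for x
        unfolding osc_def by (rule has_derivative_mult_right)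
      then show "(osc e 1 l has_derivative (\<lambda>h. v x \<bullet> h)) (at x)" for x
        unfolding l_cancel by (simp add: v_def inner_commute[of e])
    qed
    also have "\<dots> \<le> ennreal ?A"
      using assms V l by (intro Lp_norm_le[where D = \<Omega>]) (auto simp: v_def)
    finally show "sobolev_seminorm \<Omega> 1 p (osc e 1 l) \<le> ennreal ?A" .
    show "osc e 1 l \<in> borel_measurable (lebesgue_on \<Omega>)"
      by (intro continuous_borel_measurable_lebesgue_on continuous_osc)
  qed (use assms in auto)
  then show ?thesis by blast
qed

lemma has_real_derivative_max_0_squared:
  "((\<lambda>t::real. (max 0 t)\<^sup>2) has_real_derivative 2 * max 0 t) (at t)"
proof -
  consider "0 < t" | "t < 0" | "t = 0" by linarith
  then show ?thesis
  proof cases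
    case 1
    have "((\<lambda>t::real. t\<^sup>2) has_real_derivative 2 * max 0 t) (at t)"
      using 1 by (auto intro!: derivative_eq_intros)
    then show ?thesis
      by (rule has_field_derivative_transform_within_open[where S = "{0<..}"]) (use 1 in auto)
  next
    case 2
    have "((\<lambda>t::real. 0) has_real_derivative 2 * max 0 t) (at t)" using 2 by simp
    then show ?thesis
      by (rule has_field_derivative_transform_within_open[where S = "{..<0}"]) (use 2 in auto)
  next
    case 3
    have "(\<lambda>h. ((max 0 (0 + h))\<^sup>2 - (max 0 0)\<^sup>2) / h) = (\<lambda>h::real. max 0 h)"
      by (auto simp: max_def power2_eq_square)
    moreover have "((\<lambda>h::real. max 0 h) \<longlongrightarrow> max 0 0) (at 0)" by (intro tendsto_intros)
    ultimately show ?thesis using 3 by (simp only: DERIV_def) simp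
  qed
qed

lemma bump_has_derivative:
  "(bump x0 l has_derivative
     (\<lambda>h. (- 4 * l\<^sup>2 * max 0 (1 - (l * norm (x - x0))\<^sup>2)) *\<^sub>R (x - x0) \<bullet> h)) (at x)"
proof -
  have "((\<lambda>x. 1 - l\<^sup>2 * ((x - x0) \<bullet> (x - x0))) has_derivative (\<lambda>h. - 2 * l\<^sup>2 * ((x - x0) \<bullet> h))) (at x)"
    by (auto intro!: derivative_eq_intros simp: inner_commute)
  from has_derivative_compose[OF this has_real_derivative_max_0_squared[unfolded has_field_derivative_def]]
  have "((\<lambda>x. (max 0 (1 - l\<^sup>2 * ((x - x0) \<bullet> (x - x0))))\<^sup>2) has_derivative
      (\<lambda>h. 2 * max 0 (1 - l\<^sup>2 * ((x - x0) \<bullet> (x - x0))) * (- 2 * l\<^sup>2 * ((x - x0) \<bullet> h)))) (at x)" .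
  moreover have "l\<^sup>2 * ((x - x0) \<bullet> (x - x0)) = (l * norm (x - x0))\<^sup>2" for x
    by (simp add: power_mult_distrib power2_norm_eq_inner)
  ultimately show ?thesis by (simp add: bump_def[abs_def] mult_ac)
qed

text \<open>The L^N norm of the gradient is scale invariant: a gradient of size at most 4 l lives on
  a ball of volume of order l^(-N).\<close>

lemma bump_gradient_bounded:
  fixes \<Omega> :: "'a::euclidean_space set"
  assumes "open \<Omega>"
  shows "\<exists>B. \<forall>l\<ge>1. bump x0 l \<in> sobolev_space \<Omega> 1 (ereal (real DIM('a))) \<and>
     sobolev_norm \<Omega> 1 (ereal (real DIM('a))) (bump x0 l) \<le> ennreal B"
proof -
  let ?N = "real DIM('a)"
  define V where "V = unit_ball_vol ?N"
  have V: "0 \<le> V" by (simp add: V_def)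
  let ?A = "(1 powr ?N * V) powr (1 / ?N)" and ?B = "(4 powr ?N * V) powr (1 / ?N)"
  have "bump x0 l \<in> sobolev_space \<Omega> 1 (ereal ?N) \<and>
     sobolev_norm \<Omega> 1 (ereal ?N) (bump x0 l) \<le> ennreal ((?B powr ?N + ?A powr ?N) powr (1 / ?N))"
    if l: "1 \<le> l" for l
  proof (rule sobolev_space_bounded)
    have vol: "emeasure lborel (ball x0 (1 / l)) = ennreal (V * (1 / l) ^ DIM('a))"
      using l by (simp add: emeasure_ball V_def)
    have "(1 / l) ^ DIM('a) \<le> 1" using l by (intro power_le_one) auto
    then have "V * (1 / l) ^ DIM('a) \<le> V" using V by (metis mult.right_neutral mult_left_mono)
    then have vol1: "emeasure lborel (ball x0 (1 / l)) \<le> ennreal V"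
      unfolding vol by (rule ennreal_leI)
    show "Lp_norm \<Omega> ?N (bump x0 l) \<le> ennreal ?A"
      using assms V l vol1 bump_bounds[of x0 l] bump_outside[of l _ x0]
      by (intro Lp_norm_le[where D = "ball x0 (1 / l)"]) (auto simp: indicator_def)
    define v where "v x = (- 4 * l\<^sup>2 * max 0 (1 - (l * norm (x - x0))\<^sup>2)) *\<^sub>R (x - x0)" for x
    \<comment> \<open>With r = l |x - x0| the norm is 4 l max(0, 1 - r^2) r, and both of the last
      factors are at most 1 inside the ball.\<close>
    have vb: "norm (v x) \<le> 4 * l * indicator (ball x0 (1 / l)) x" for x
    proof (cases "x \<in> ball x0 (1 / l)")
      case True
      then have "l * norm (x - x0) \<le> 1" using l by (simp add: dist_norm norm_minus_commute field_simps)
      moreover have "max 0 (1 - (l * norm (x - x0))\<^sup>2) \<le> 1" by simp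
      ultimately have "max 0 (1 - (l * norm (x - x0))\<^sup>2) * (l * norm (x - x0)) \<le> 1 * 1"
        using l by (intro mult_mono) auto
      then have "4 * l * (max 0 (1 - (l * norm (x - x0))\<^sup>2) * (l * norm (x - x0))) \<le> 4 * l * 1"
        using l by (intro mult_left_mono) auto
      then show ?thesis using True
        by (simp add: v_def abs_mult power2_eq_square mult_ac)
    next
      case False
      then have "1 \<le> l * norm (x - x0)"
        using l by (simp add: dist_norm norm_minus_commute field_simps)
      then have "1 \<le> (l * norm (x - x0))\<^sup>2" by (rule one_le_power)
      then show ?thesis using False by (simp add: v_def)
    qed
    have "sobolev_seminorm \<Omega> 1 ?N (bump x0 l) \<le> Lp_norm \<Omega> ?N v"
    proof (rule sobolev_seminorm_1_le[OF \<open>open \<Omega>\<close>])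
      show "continuous_on UNIV v" unfolding v_def by (intro continuous_intros)
      show "(bump x0 l has_derivative (\<lambda>h. v x \<bullet> h)) (at x)" for x
        unfolding v_def by (rule bump_has_derivative)
    qed
    also have "\<dots> \<le> ennreal (((4 * l) powr ?N * (V * (1 / l) ^ DIM('a))) powr (1 / ?N))"
      using assms V l vol vb by (intro Lp_norm_le[where D = "ball x0 (1 / l)"]) auto
    also have "(4 * l) powr ?N * (V * (1 / l) ^ DIM('a)) = 4 powr ?N * V"
      using l by (simp add: powr_mult powr_realpow power_divide)
    finally show "sobolev_seminorm \<Omega> 1 ?N (bump x0 l) \<le> ennreal ?B" .
    show "bump x0 l \<in> borel_measurable (lebesgue_on \<Omega>)"
      by (intro continuous_borel_measurable_lebesgue_on continuous_bump)
  qed auto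
  then show ?thesis by blast
qed

text \<open>Instead of Hoelder's inequality, \<open>t \<le> \<delta> + \<delta> powr (1 - q) * t powr q\<close> suffices here.\<close>

lemma Lp_norm_ge_pairing:
  fixes v :: "'a::euclidean_space \<Rightarrow> 'a"
  assumes "open \<Omega>" and V: "emeasure lborel \<Omega> \<le> ennreal V" "0 \<le> V"
    and "1 \<le> q" "0 < a" "norm e = 1"
    and v: "set_integrable lebesgue K v" and \<psi>: "\<And>x. \<bar>\<psi> x\<bar> \<le> indicator K x"
    and a: "a \<le> \<bar>LINT x|lebesgue_on \<Omega>. (v x \<bullet> e) * \<psi> x\<bar>"
  shows "ennreal ((a / 2 * (a / (2 * (V + 1))) powr (q - 1)) powr (1 / q)) \<le> Lp_norm \<Omega> q v"
proof -
  \<comment> \<open>Chosen so that the constant term, integrated over \<Omega>, uses up at most half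
    of \<open>a\<close>; the \<open>+ 1\<close> keeps the denominator positive if
    \<open>V = 0\<close>.\<close>
  define d where "d = a / (2 * (V + 1))"
  have d: "0 < d" using assms by (simp add: d_def)
  define m where "m = a / 2 * d powr (q - 1)"
  have m: "0 < m" using d assms by (simp add: m_def)
  define P where "P = (\<integral>\<^sup>+x. ennreal (norm (v x) powr q) \<partial>lebesgue_on \<Omega>)"
  \<comment> \<open>The Bochner integral of a non-integrable function is 0 by convention, so a
    nonzero integral certifies integrability.\<close>
  have int: "integrable (lebesgue_on \<Omega>) (\<lambda>x. (v x \<bullet> e) * \<psi> x)"
    using a assms(5) not_integrable_integral_eq by fastforce
  \<comment> \<open>\<open>v\<close> is known to be integrable on \<open>K\<close> only, so
    measurability is available for its cut-off.\<close>
  have [measurable]: "(\<lambda>x. indicator K x *\<^sub>R v x) \<in> borel_measurable (lebesgue_on \<Omega>)"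
    using v by (intro measurable_restrict_space1) (auto simp: set_integrable_def dest: borel_measurable_integrable)
  define g where "g x = ennreal (norm (indicator K x *\<^sub>R v x) powr q)" for x
  have g [measurable]: "g \<in> borel_measurable (lebesgue_on \<Omega>)" unfolding g_def by measurable
  have pw: "ennreal (norm ((v x \<bullet> e) * \<psi> x)) \<le> ennreal d + ennreal (d powr (1 - q)) * g x" for x
  proof -
    define t where "t = norm (indicator K x *\<^sub>R v x)"
    have "\<bar>v x \<bullet> e\<bar> \<le> norm (v x)" using Cauchy_Schwarz_ineq2[of "v x" e] assms by simp
    then have "norm ((v x \<bullet> e) * \<psi> x) \<le> norm (v x) * indicator K x"
      using \<psi>[of x] by (simp add: abs_mult mult_mono)
    also have "\<dots> = t" by (simp add: t_def indicator_def)
    also have "t \<le> d + d powr (1 - q) * t powr q"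
    proof (cases "t \<le> d")
      case True
      then show ?thesis using d by (intro add_increasing2) auto
    next
      case False
      then have "t powr (1 - q) \<le> d powr (1 - q)" using d assms by (intro powr_mono2') auto
      then have "t powr (1 - q) * t powr q \<le> d powr (1 - q) * t powr q" by (intro mult_right_mono) auto
      moreover have "t powr (1 - q) * t powr q = t" using False d by (simp add: powr_add[symmetric])
      ultimately show ?thesis using d by simp
    qed
    finally have "ennreal (norm ((v x \<bullet> e) * \<psi> x)) \<le> ennreal (d + d powr (1 - q) * t powr q)"
      by (rule ennreal_leI)
    then show ?thesis using d by (simp add: g_def t_def ennreal_mult)
  qed
  have "ennreal a \<le> ennreal (norm (LINT x|lebesgue_on \<Omega>. (v x \<bullet> e) * \<psi> x))"
    using a by (intro ennreal_leI) simp
  also have "\<dots> \<le> (\<integral>\<^sup>+x. norm ((v x \<bullet> e) * \<psi> x) \<partial>lebesgue_on \<Omega>)"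
    by (rule integral_norm_bound_ennreal[OF int])
  also have "\<dots> \<le> (\<integral>\<^sup>+x. ennreal d + ennreal (d powr (1 - q)) * g x \<partial>lebesgue_on \<Omega>)"
    by (intro nn_integral_mono pw)
  also have "\<dots> = (\<integral>\<^sup>+x. ennreal d \<partial>lebesgue_on \<Omega>) + (\<integral>\<^sup>+x. ennreal (d powr (1 - q)) * g x \<partial>lebesgue_on \<Omega>)"
    by (rule nn_integral_add) measurable
  also have "\<dots> = ennreal d * emeasure (lebesgue_on \<Omega>) (space (lebesgue_on \<Omega>))
      + ennreal (d powr (1 - q)) * (\<integral>\<^sup>+x. g x \<partial>lebesgue_on \<Omega>)"
    by (simp only: nn_integral_const nn_integral_cmult[OF g])
  also have "\<dots> \<le> ennreal d * ennreal V + ennreal (d powr (1 - q)) * P"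
  proof (intro add_mono mult_left_mono)
    show "emeasure (lebesgue_on \<Omega>) (space (lebesgue_on \<Omega>)) \<le> ennreal V"
      using V(1) \<open>open \<Omega>\<close> by (subst emeasure_restrict_space) (auto simp: space_restrict_space)
    show "(\<integral>\<^sup>+x. g x \<partial>lebesgue_on \<Omega>) \<le> P"
      unfolding P_def g_def by (intro nn_integral_mono) (auto simp: indicator_def)
  qed auto
  also have "ennreal d * ennreal V \<le> ennreal (a / 2)"
  proof -
    have "d * V \<le> d * (V + 1)" using d by simp
    also have "\<dots> = a / 2" using V by (simp add: d_def field_simps)
    finally show ?thesis using d V by (simp add: ennreal_mult[symmetric] ennreal_leI)
  qed
  finally have main: "ennreal a \<le> ennreal (a / 2) + ennreal (d powr (1 - q)) * P"
    by (simp add: add_right_mono)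
  have "ennreal m \<le> P"
  proof (cases P)
    case (real r)
    have "ennreal a \<le> ennreal (a / 2 + d powr (1 - q) * r)"
      using main real assms by (simp add: ennreal_mult)
    then have "a \<le> a / 2 + d powr (1 - q) * r" using real assms by (subst (asm) ennreal_le_iff) auto
    then have "a / 2 * d powr (q - 1) \<le> (d powr (1 - q) * r) * d powr (q - 1)"
      by (intro mult_right_mono) auto
    also have "\<dots> = (d powr (1 - q) * d powr (q - 1)) * r" by simp
    also have "d powr (1 - q) * d powr (q - 1) = 1" using d by (simp add: powr_add[symmetric])
    finally show ?thesis using real by (simp add: m_def ennreal_leI)
  qed simp
  then have "enn_powr (ennreal m) (1 / q) \<le> enn_powr P (1 / q)"
    using assms by (intro enn_powr_mono) auto
  then show ?thesis using m by (simp add: enn_powr_ennreal Lp_norm_def P_def m_def d_def)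
qed

text \<open>Every weak gradient is tested against \<eta> cos(l (x \<bullet> e)), in phase with the
  expected gradient. Moving the derivative to the test function reduces the pairing to
  \<open>A\<close> and \<open>T\<close>, and the mean of sin^2 over the cut-off, about one half,
  comes from a second integration by parts instead of the Riemann-Lebesgue lemma.\<close>

lemma osc_gradient_lower:
  fixes \<Omega> :: "'a::euclidean_space set"
  assumes "open \<Omega>" "bounded \<Omega>" "x0 \<in> \<Omega>" and e: "e \<in> Basis" and "s \<le> 1" "1 \<le> q"
  shows "\<exists>c>0. \<exists>l0\<ge>1. \<forall>l\<ge>l0. \<forall>w\<in>borel_measurable (lebesgue_on \<Omega>).
    (AE x in lebesgue_on \<Omega>. w x = osc e s l x) \<longrightarrow> c \<le> sobolev_seminorm \<Omega> 1 q w"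
proof -
  define V where "V = measure lborel \<Omega>"
  have V: "emeasure lborel \<Omega> \<le> ennreal V" "0 \<le> V"
    using emeasure_bounded_finite[OF \<open>bounded \<Omega>\<close>] by (auto simp: V_def emeasure_eq_ennreal_measure)
  obtain d where d: "0 < d" "cball x0 d \<subseteq> \<Omega>" using assms open_contains_cball by blast
  define K where "K = cball x0 d"
  have K: "compact K" "K \<subseteq> \<Omega>" "closed K" using d by (auto simp: K_def)
  have ee: "e \<bullet> e = 1" "norm e = 1" using e by auto
  define \<eta> where "\<eta> x = flat_exp 0 (d\<^sup>2 - (x - x0) \<bullet> (x - x0))" for x
  have smooth_\<eta>: "smooth_class x0 (d\<^sup>2) l e \<eta>" for l
    unfolding \<eta>_def by (rule smooth_class.flat)
  have dist2: "(x - x0) \<bullet> (x - x0) = (dist x0 x)\<^sup>2" for x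
    by (metis dist_commute dist_norm power2_norm_eq_inner)
  have \<eta>_pos: "0 < \<eta> x" if "dist x0 x < d" for x
  proof -
    have "(x - x0) \<bullet> (x - x0) = (dist x0 x)\<^sup>2" by (rule dist2)
    also have "\<dots> < d\<^sup>2" using that d by (intro power_strict_mono) auto
    finally show ?thesis by (simp add: \<eta>_def flat_exp_def)
  qed
  have \<eta>_off: "\<eta> x = 0" if "x \<notin> K" for x
  proof -
    have "d\<^sup>2 \<le> (dist x0 x)\<^sup>2" using that d by (intro power_mono) (auto simp: K_def)
    also have "\<dots> = (x - x0) \<bullet> (x - x0)"
      by (rule dist2[symmetric])
    finally show ?thesis by (simp add: \<eta>_def flat_exp_def)
  qed
  have \<eta>_bounds: "0 \<le> \<eta> x" "\<eta> x \<le> 1" for x by (auto simp: \<eta>_def flat_exp_def)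
  \<comment> \<open>The cut-off does not involve the frequency, so the class may be taken at
    frequency 0. This fixes its derivative, and hence \<open>M\<close>, before \<open>l\<close> is
    chosen.\<close>
  obtain D where D: "\<And>x. (\<eta> has_derivative D x) (at x)" "\<And>b. smooth_class x0 (d\<^sup>2) 0 e (\<lambda>x. D x b)"
    using smooth_class_derivative[OF smooth_\<eta>] by blast
  define \<eta>' where "\<eta>' x = D x e" for x
  have \<eta>'_off: "\<eta>' x = 0" if "x \<notin> K" for x
    using frechet_derivative_eq_0_outside[OF K(3) \<eta>_off that, where b = e] frechet_derivative_at[OF D(1)]
    by (simp add: \<eta>'_def)
  have c\<eta>: "continuous_on UNIV \<eta>" using smooth_class_Ck[OF smooth_\<eta>, of 0] by simp
  have c\<eta>': "continuous_on UNIV \<eta>'" using smooth_class_Ck[OF D(2), of 0] by (simp add: \<eta>'_def)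
  have intg: "integrable lborel f" if "continuous_on UNIV f" "\<And>x. x \<notin> K \<Longrightarrow> f x = 0" for f :: "'a \<Rightarrow> real"
    using that K by (intro integrable_compact_support)
  define I where "I = (LINT x|lborel. \<eta> x)"
  define M where "M = (LINT x|lborel. \<bar>\<eta>' x\<bar>)"
  have i\<eta>: "integrable lborel \<eta>" by (intro intg c\<eta> \<eta>_off)
  have "I \<noteq> 0"
  proof
    assume "I = 0"
    then have "AE x in lborel. \<eta> x = 0"
      unfolding I_def using integral_nonneg_eq_0_iff_AE[OF i\<eta>] \<eta>_bounds by simp
    then have "AE x in lebesgue_on UNIV. \<eta> x = 0" unfolding lebesgue_on_UNIV_eq by (rule AE_completion)
    from AE_lebesgue_on_open_witness[OF open_UNIV UNIV_I d(1) this] \<eta>_pos show False by force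
  qed
  then have I: "0 < I" using \<eta>_bounds by (simp add: I_def integral_nonneg less_le)
  \<comment> \<open>The pairing will equal l^(-s) (l I - A) / 2. Since A \<le> M and l \<ge> 2 M /
    I, it is at least l^(1 - s) I / 4, and s \<le> 1 removes the power of l.\<close>
  let ?a = "I / 4"
  let ?c = "ennreal ((?a / 2 * (?a / (2 * (V + 1))) powr (q - 1)) powr (1 / q))"
  have "0 < ?c" using I V by simp
  moreover have "?c \<le> sobolev_seminorm \<Omega> 1 q w"
    if l: "max 1 (2 * M / I) \<le> l" and w [measurable]: "w \<in> borel_measurable (lebesgue_on \<Omega>)"
      and ae: "AE x in lebesgue_on \<Omega>. w x = osc e s l x" for l w
  proof -
    have l1: "1 \<le> l" "2 * M \<le> l * I" using l I by (auto simp: field_simps)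
    define S C where "S x = sin (l * (x \<bullet> e))" and "C x = cos (l * (x \<bullet> e))" for x
    have cS: "continuous_on UNIV S" and cC: "continuous_on UNIV C"
      unfolding S_def C_def by (intro continuous_intros)+
    have dS: "(S has_derivative (\<lambda>b. C x * (l * (b \<bullet> e)))) (at x)"
      and dC: "(C has_derivative (\<lambda>b. - S x * (l * (b \<bullet> e)))) (at x)" for x
      unfolding S_def C_def by (auto intro!: derivative_eq_intros)
    have SC: "(C x)\<^sup>2 = 1 - (S x)\<^sup>2" for x by (simp add: S_def C_def cos_squared_eq)
    define \<psi> where "\<psi> x = \<eta> x * C x" for x
    have "smooth_class x0 (d\<^sup>2) l e \<psi>"
      unfolding \<psi>_def C_def by (intro smooth_class.mult smooth_\<eta> smooth_class.cos)
    then have test: "test_function \<Omega> \<psi>"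
      unfolding test_function_def using K \<eta>_off smooth_class_Ck by (auto simp: \<psi>_def)
    have "(\<psi> has_derivative (\<lambda>b. \<eta> x * (- S x * (l * (b \<bullet> e))) + D x b * C x)) (at x)" for x
      unfolding \<psi>_def by (rule has_derivative_mult[OF D(1) dC])
    then have "frechet_derivative \<psi> (at x) = (\<lambda>b. \<eta> x * (- S x * (l * (b \<bullet> e))) + D x b * C x)" for x
      by (rule frechet_derivative_at[symmetric])
    then have d\<psi>: "frechet_derivative \<psi> (at x) e = \<eta>' x * C x - l * (\<eta> x * S x)" for x
      by (simp add: \<eta>'_def ee)
    define A where "A = (LINT x|lborel. \<eta>' x * S x * C x)"
    define T where "T = (LINT x|lborel. \<eta> x * (S x)\<^sup>2)"
    have iA: "integrable lborel (\<lambda>x. \<eta>' x * S x * C x)"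
      by (intro intg continuous_intros c\<eta>' cS cC) (simp add: \<eta>'_off)
    have iT: "integrable lborel (\<lambda>x. \<eta> x * (S x)\<^sup>2)"
      by (intro intg continuous_intros c\<eta> cS) (simp add: \<eta>_off)
    \<comment> \<open>The derivative of \<eta> S C along \<open>e\<close> contains l \<eta> (C^2 -
      S^2), with C^2 - S^2 = 1 - 2 S^2. Its vanishing integral determines \<open>T\<close> as I/2
      plus the error A/(2 l).\<close>
    have "(LINT x|lborel. \<eta>' x * S x * C x + l * (\<eta> x - 2 * (\<eta> x * (S x)\<^sup>2))) = 0"
    proof (rule integral_directional_derivative_eq_0[OF _ _ _ K(1), of "\<lambda>x. \<eta> x * (S x * C x)" e])
      fix x
      have "((\<lambda>x. \<eta> x * (S x * C x)) has_derivative
          (\<lambda>b. \<eta> x * (S x * (- S x * (l * (b \<bullet> e))) + C x * (l * (b \<bullet> e)) * C x) + D x b * (S x * C x))) (at x)"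
        by (intro has_derivative_mult D(1) dS dC)
      from has_derivative_imp_directional[OF this, of e]
      have "((\<lambda>t. \<eta> (x + t *\<^sub>R e) * (S (x + t *\<^sub>R e) * C (x + t *\<^sub>R e))) has_real_derivative
          \<eta> x * (l * ((C x)\<^sup>2 - (S x)\<^sup>2)) + \<eta>' x * (S x * C x)) (at 0)"
        by (simp add: ee \<eta>'_def power2_eq_square algebra_simps)
      then show "((\<lambda>t. \<eta> (x + t *\<^sub>R e) * (S (x + t *\<^sub>R e) * C (x + t *\<^sub>R e))) has_real_derivative
          \<eta>' x * S x * C x + l * (\<eta> x - 2 * (\<eta> x * (S x)\<^sup>2))) (at 0)"
        unfolding SC by (simp add: algebra_simps)
    qed (auto intro!: continuous_intros c\<eta> c\<eta>' cS cC simp: \<eta>_off \<eta>'_off)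
    then have "A + l * (I - 2 * T) = 0"
      using iA iT i\<eta> by (simp add: A_def T_def I_def)
    then have lT: "l * T = (A + l * I) / 2" by (simp add: algebra_simps)
    have "A \<le> M"
      unfolding A_def M_def
    proof (rule integral_mono[OF iA])
      show "integrable lborel (\<lambda>x. \<bar>\<eta>' x\<bar>)"
        by (intro intg continuous_intros c\<eta>') (simp add: \<eta>'_off)
      fix x
      have "\<bar>\<eta>' x\<bar> * \<bar>S x\<bar> * \<bar>C x\<bar> \<le> \<bar>\<eta>' x\<bar> * 1 * 1"
        by (intro mult_mono) (auto simp: S_def C_def)
      then show "\<eta>' x * S x * C x \<le> \<bar>\<eta>' x\<bar>"
        using abs_ge_self[of "\<eta>' x * S x * C x"] by (simp add: abs_mult)
    qed
    have "?c \<le> Lp_norm \<Omega> q v" if v: "has_weak_gradient \<Omega> w v" for v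
    proof (rule Lp_norm_ge_pairing[OF \<open>open \<Omega>\<close> V \<open>1 \<le> q\<close> _ ee(2)])
      show "set_integrable lebesgue K v" using v K by (auto simp: has_weak_gradient_def locally_integrable_def)
      show "\<bar>\<psi> x\<bar> \<le> indicator K x" for x
      proof (cases "x \<in> K")
        case True
        have "\<bar>\<eta> x\<bar> * \<bar>C x\<bar> \<le> 1 * 1" using \<eta>_bounds by (intro mult_mono) (auto simp: C_def)
        then show ?thesis using True by (simp add: \<psi>_def abs_mult)
      qed (simp add: \<psi>_def \<eta>_off)
      have c: "continuous_on UNIV (\<lambda>x. osc e s l x * (\<eta>' x * C x - l * (\<eta> x * S x)))"
        by (intro continuous_intros continuous_osc c\<eta> c\<eta>' cS cC)
      have m: "osc e s l \<in> borel_measurable (lebesgue_on \<Omega>)"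
        "(\<lambda>x. \<eta>' x * C x - l * (\<eta> x * S x)) \<in> borel_measurable (lebesgue_on \<Omega>)"
        by (intro continuous_borel_measurable_lebesgue_on continuous_intros continuous_osc c\<eta> c\<eta>' cS cC)+
      have "(LINT x|lebesgue_on \<Omega>. w x * frechet_derivative \<psi> (at x) e)
          = - (LINT x|lebesgue_on \<Omega>. (v x \<bullet> e) * \<psi> x)"
        using v test e unfolding has_weak_gradient_def by blast
      then have "(LINT x|lebesgue_on \<Omega>. (v x \<bullet> e) * \<psi> x)
          = - (LINT x|lebesgue_on \<Omega>. w x * (\<eta>' x * C x - l * (\<eta> x * S x)))"
        unfolding d\<psi> by simp
      also have "(LINT x|lebesgue_on \<Omega>. w x * (\<eta>' x * C x - l * (\<eta> x * S x)))
          = (LINT x|lebesgue_on \<Omega>. osc e s l x * (\<eta>' x * C x - l * (\<eta> x * S x)))"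
      proof (rule integral_cong_AE)
        show "AE x in lebesgue_on \<Omega>. w x * (\<eta>' x * C x - l * (\<eta> x * S x))
            = osc e s l x * (\<eta>' x * C x - l * (\<eta> x * S x))"
          using ae by eventually_elim simp
      qed (intro borel_measurable_times w m)+
      also have "\<dots> = (LINT x|lborel. osc e s l x * (\<eta>' x * C x - l * (\<eta> x * S x)))"
        by (rule integral_lebesgue_on_support[OF \<open>open \<Omega>\<close> c K(2)]) (simp add: \<eta>_off \<eta>'_off)
      also have "(\<lambda>x. osc e s l x * (\<eta>' x * C x - l * (\<eta> x * S x)))
          = (\<lambda>x. l powr (- s) * (\<eta>' x * S x * C x - l * (\<eta> x * (S x)\<^sup>2)))"
        by (simp add: osc_def S_def power2_eq_square algebra_simps fun_eq_iff)
      also have "(LINT x|lborel. l powr (- s) * (\<eta>' x * S x * C x - l * (\<eta> x * (S x)\<^sup>2)))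
          = l powr (- s) * (A - l * T)"
        using iA iT by (simp add: A_def T_def)
      finally have J: "(LINT x|lebesgue_on \<Omega>. (v x \<bullet> e) * \<psi> x) = l powr (- s) * ((l * I - A) / 2)"
        unfolding lT by (simp add: algebra_simps)
      have "l powr 0 \<le> l powr (1 - s)" using l1 assms by (intro powr_mono) auto
      then have "1 \<le> l powr (- s) * l" using l1 by (simp add: powr_diff powr_minus divide_simps)
      then have "1 * I \<le> l powr (- s) * l * I" using I by (intro mult_right_mono) auto
      then have "?a \<le> l powr (- s) * ((l * I) / 4)" by simp
      also have "\<dots> \<le> l powr (- s) * ((l * I - A) / 2)"
      proof (rule mult_left_mono)
        have "2 * A \<le> l * I" using \<open>A \<le> M\<close> l1 by linarith
        then show "l * I / 4 \<le> (l * I - A) / 2" by (simp add: field_simps)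
      qed simp
      finally show "?a \<le> \<bar>LINT x|lebesgue_on \<Omega>. (v x \<bullet> e) * \<psi> x\<bar>" unfolding J by linarith
    qed (use I in simp)
    then show ?thesis by (auto simp: sobolev_seminorm_def intro: INF_greatest)
  qed
  moreover have "1 \<le> max 1 (2 * M / I)" by simp
  ultimately show ?thesis by blast
qed

subsection \<open>Failure of compactness\<close>

lemma osc_bounded:
  fixes \<Omega> :: "'a::euclidean_space set"
  assumes "open \<Omega>" "bounded \<Omega>" "norm e = 1" "0 < s" "s \<le> 1" "0 < p" "s * p = real DIM('a)"
  shows "\<exists>B. \<forall>l\<ge>1. osc e s l \<in> sobolev_space \<Omega> s (ereal p) \<and>
     sobolev_norm \<Omega> s (ereal p) (osc e s l) \<le> ennreal B"
proof (cases "s = 1")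
  case True
  then show ?thesis using osc_gradient_bounded[OF assms(1-3) \<open>0 < p\<close>] by simp
next
  case False
  then have "s < 1" using assms by simp
  then show ?thesis using osc_fractional_bounded assms by blast
qed

lemma bump_bounded:
  fixes \<Omega> :: "'a::euclidean_space set"
  assumes "open \<Omega>" "0 < s" "s \<le> 1" "s * p = real DIM('a)"
  shows "\<exists>B. \<forall>l\<ge>1. bump x0 l \<in> sobolev_space \<Omega> s (ereal p) \<and>
     sobolev_norm \<Omega> s (ereal p) (bump x0 l) \<le> ennreal B"
proof (cases "s = 1")
  case True
  then have "p = real DIM('a)" using assms by simp
  then show ?thesis using bump_gradient_bounded[OF assms(1), of x0] True by simp
next
  case False
  then have "s < 1" using assms by simp
  then show ?thesis using bump_fractional_bounded assms by blast
qed

lemma bump_tendsto_0: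
  assumes "x \<noteq> x0"
  shows "(\<lambda>n. bump x0 (l0 + real n) x) \<longlonglongrightarrow> 0"
proof (rule tendsto_eventually)
  have "filterlim (\<lambda>n. l0 + real n) at_top sequentially"
    by (rule filterlim_tendsto_add_at_top[OF tendsto_const filterlim_real_sequentially])
  then have "\<forall>\<^sub>F n in sequentially. max 1 (1 / norm (x - x0)) \<le> l0 + real n"
    unfolding filterlim_at_top by blast
  then show "\<forall>\<^sub>F n in sequentially. bump x0 (l0 + real n) x = 0"
  proof eventually_elim
    case (elim n)
    then show ?case using assms
      by (intro bump_outside) (auto simp: dist_norm norm_minus_commute field_simps)
  qed
qed

lemma osc_tendsto_0:
  assumes "0 < s"
  shows "(\<lambda>n. osc e s (l0 + real n) x) \<longlonglongrightarrow> 0"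
proof (rule Lim_null_comparison)
  show "\<forall>\<^sub>F n in sequentially. norm (osc e s (l0 + real n) x) \<le> (l0 + real n) powr (- s)"
    by (rule always_eventually) (auto simp: osc_def abs_mult intro: mult_left_le)
  have "filterlim (\<lambda>n. l0 + real n) at_top sequentially"
    by (rule filterlim_tendsto_add_at_top[OF tendsto_const filterlim_real_sequentially])
  then show "(\<lambda>n. (l0 + real n) powr (- s)) \<longlonglongrightarrow> 0"
    using assms by (intro tendsto_neg_powr) auto
qed

lemma AE_lebesgue_on_neq: "AE x in lebesgue_on \<Omega>. x \<noteq> (x0 :: 'a::euclidean_space)" if "open \<Omega>"
proof -
  have "AE x in lborel. x \<noteq> x0" by (rule AE_lborel_singleton)
  then have "AE x in lebesgue. x \<noteq> x0" by (rule AE_completion)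
  then show ?thesis using that by (subst AE_restrict_space_iff) (auto elim: eventually_mono)
qed

lemma not_compactly_embedded_bump:
  fixes \<Omega> :: "'a::euclidean_space set"
  assumes "open \<Omega>" "\<Omega> \<noteq> {}" "0 < s" "s \<le> 1" "s * p = real DIM('a)"
    and "0 < t" "t < 1" "1 \<le> q" "real DIM('a) \<le> t * q"
  shows "\<not> compactly_embedded (sobolev_space \<Omega> s (ereal p)) (sobolev_norm \<Omega> s (ereal p))
    (sobolev_space \<Omega> t (ereal q)) (sobolev_norm \<Omega> t (ereal q))"
proof -
  obtain x0 where x0: "x0 \<in> \<Omega>" using assms by auto
  obtain B where B: "\<forall>l\<ge>1. bump x0 l \<in> sobolev_space \<Omega> s (ereal p) \<and>
     sobolev_norm \<Omega> s (ereal p) (bump x0 l) \<le> ennreal B"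
    using bump_bounded[OF assms(1,3,4,5)] by blast
  obtain c l0 where c: "0 < c" "1 \<le> l0" "\<forall>l\<ge>l0. \<forall>w. (AE x in lebesgue_on \<Omega>. w x = bump x0 l x) \<longrightarrow>
    c \<le> sobolev_seminorm \<Omega> t q w"
    using bump_fractional_lower[OF assms(1) x0 assms(6-9)] by blast
  \<comment> \<open>Starting the sequence at \<open>l0\<close> keeps every scale in the range of
    both the upper bound (\<open>l \<ge> 1\<close>) and the lower bound
    (\<open>l \<ge> l0\<close>).\<close>
  show ?thesis
  proof (rule not_compactly_embedded_seminorm[OF _ _ c(1), where f = "\<lambda>n. bump x0 (l0 + real n)" and B = B])
    show "AE x in lebesgue_on \<Omega>. (\<lambda>n. bump x0 (l0 + real n) x) \<longlonglongrightarrow> 0"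
      using AE_lebesgue_on_neq[OF assms(1)] by eventually_elim (rule bump_tendsto_0)
    show "bump x0 (l0 + real n) \<in> borel_measurable (lebesgue_on \<Omega>)" for n
      by (intro continuous_borel_measurable_lebesgue_on continuous_bump)
    show "c \<le> sobolev_seminorm \<Omega> t q w"
      if "AE x in lebesgue_on \<Omega>. w x = bump x0 (l0 + real n) x" for n w
      by (rule c(3)[rule_format, OF _ that]) simp
  qed (use B c(2) assms in auto)
qed

lemma not_compactly_embedded_bump_Linf:
  fixes \<Omega> :: "'a::euclidean_space set"
  assumes "open \<Omega>" "\<Omega> \<noteq> {}" "0 < s" "s \<le> 1" "s * p = real DIM('a)"
  shows "\<not> compactly_embedded (sobolev_space \<Omega> s (ereal p)) (sobolev_norm \<Omega> s (ereal p))
    (sobolev_space \<Omega> t \<infinity>) (sobolev_norm \<Omega> t \<infinity>)"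
proof -
  obtain x0 where x0: "x0 \<in> \<Omega>" using assms by auto
  obtain B where B: "\<forall>l\<ge>1. bump x0 l \<in> sobolev_space \<Omega> s (ereal p) \<and>
     sobolev_norm \<Omega> s (ereal p) (bump x0 l) \<le> ennreal B"
    using bump_bounded[OF assms(1,3,4,5)] by blast
  show ?thesis
  proof (rule not_compactly_embedded_Linf[OF assms(1) x0, where f = "\<lambda>n. bump x0 (1 + real n)" and B = B])
    show "AE x in lebesgue_on \<Omega>. (\<lambda>n. bump x0 (1 + real n) x) \<longlonglongrightarrow> 0"
      using AE_lebesgue_on_neq[OF assms(1)] by eventually_elim (rule bump_tendsto_0)
    show "isCont (bump x0 (1 + real n)) x0" for n
      using continuous_bump[of x0 "1 + real n"] by (simp add: continuous_on_eq_continuous_at)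
  qed (use B in \<open>auto simp: bump_center\<close>)
qed

lemma not_compactly_embedded_osc:
  fixes \<Omega> :: "'a::euclidean_space set"
  assumes "open \<Omega>" "bounded \<Omega>" "\<Omega> \<noteq> {}" "0 < s" "s \<le> 1" "0 < p" "s * p = real DIM('a)"
    and "s \<le> t" "t \<le> 1" "1 \<le> q"
  shows "\<not> compactly_embedded (sobolev_space \<Omega> s (ereal p)) (sobolev_norm \<Omega> s (ereal p))
    (sobolev_space \<Omega> t (ereal q)) (sobolev_norm \<Omega> t (ereal q))"
proof -
  obtain x0 where x0: "x0 \<in> \<Omega>" using assms by auto
  \<comment> \<open>A coordinate direction, because weak gradients are tested only along
    \<open>Basis\<close>.\<close>
  obtain e :: 'a where e: "e \<in> Basis" using SOME_Basis by blast
  then have ne: "norm e = 1" by simp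
  obtain B where B: "\<forall>l\<ge>1. osc e s l \<in> sobolev_space \<Omega> s (ereal p) \<and>
     sobolev_norm \<Omega> s (ereal p) (osc e s l) \<le> ennreal B"
    using osc_bounded[OF assms(1,2) ne assms(4-7)] by blast
  have "\<exists>c>0. \<exists>l0\<ge>1. \<forall>l\<ge>l0. \<forall>w\<in>borel_measurable (lebesgue_on \<Omega>).
    (AE x in lebesgue_on \<Omega>. w x = osc e s l x) \<longrightarrow> c \<le> sobolev_seminorm \<Omega> t q w"
  proof (cases "t = 1")
    case True
    then show ?thesis using osc_gradient_lower[OF assms(1,2) x0 e assms(5,10)] by simp
  next
    case False
    then have "0 < t" "t < 1" using assms by auto
    then show ?thesis using osc_fractional_lower[OF assms(1) x0 ne _ _ assms(10,8)] by blast
  qed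
  then obtain c l0 where c: "0 < c" "1 \<le> l0" "\<forall>l\<ge>l0. \<forall>w\<in>borel_measurable (lebesgue_on \<Omega>).
    (AE x in lebesgue_on \<Omega>. w x = osc e s l x) \<longrightarrow> c \<le> sobolev_seminorm \<Omega> t q w"
    by blast
  show ?thesis
  proof (rule not_compactly_embedded_seminorm[OF _ _ c(1), where f = "\<lambda>n. osc e s (l0 + real n)" and B = B])
    show "AE x in lebesgue_on \<Omega>. (\<lambda>n. osc e s (l0 + real n) x) \<longlonglongrightarrow> 0"
      using assms by (intro always_eventually allI osc_tendsto_0)
    show "osc e s (l0 + real n) \<in> borel_measurable (lebesgue_on \<Omega>)" for n
      by (intro continuous_borel_measurable_lebesgue_on continuous_osc)
    show "c \<le> sobolev_seminorm \<Omega> t q w"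
      if "w \<in> borel_measurable (lebesgue_on \<Omega>)"
        "AE x in lebesgue_on \<Omega>. w x = osc e s (l0 + real n) x" for n w
      by (rule c(3)[rule_format, OF _ that]) simp
  qed (use B c(2) assms in auto)
qed

theorem proposition2p13:
  fixes s p st :: real and pt :: ereal and \<Omega> :: "(real ^ 'n) set"
  assumes "0 < s" "s \<le> 1" and "1 \<le> p"
    and "s * p = real CARD('n)" and "s \<noteq> p"
    and "open \<Omega>" "bounded \<Omega>" "connected \<Omega>" "\<Omega> \<noteq> {}" and "lipschitz_boundary \<Omega>"
    and "0 \<le> st" "st \<le> 1" and "1 \<le> pt"
    and "\<not> ((0 < st \<and> st < s \<and> 1 \<le> pt \<and> pt < ereal (real CARD('n) / st)) \<or>
             (st = 0 \<and> 1 \<le> pt \<and> pt < \<infinity>))"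
  shows "\<not> compactly_embedded (sobolev_space \<Omega> s (ereal p)) (sobolev_norm \<Omega> s (ereal p))
             (sobolev_space \<Omega> st pt) (sobolev_norm \<Omega> st pt)"
proof -
  have sp: "s * p = real DIM(real ^ 'n)" using assms(4) by simp
  show ?thesis
  proof (cases pt)
    case (real q)
    then have q: "1 \<le> q" using \<open>1 \<le> pt\<close> by simp
    \<comment> \<open>For finite \<open>pt\<close> the value \<open>st = 0\<close> would satisfy the
      second excluded alternative.\<close>
    have st: "0 < st" using assms real by force
    show ?thesis
    proof (cases "st < s")
      case True
      \<comment> \<open>Below \<open>s\<close>, the first alternative can fail only through its
        bound on the exponent, which puts the target at or beyond the critical line
        \<open>st * q = N\<close>.\<close>
      then have "real CARD('n) / st \<le> q" using assms st real by auto
      then have "real DIM(real ^ 'n) \<le> st * q" using st by (simp add: field_simps)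
      then show ?thesis using not_compactly_embedded_bump[OF assms(6,9,1,2) sp st _ q] True assms real by simp
    next
      case False
      then show ?thesis using not_compactly_embedded_osc[OF assms(6,7,9,1,2) _ sp _ assms(12) q] assms real by simp
    qed
  next
    case PInf
    then show ?thesis using not_compactly_embedded_bump_Linf[OF assms(6,9,1,2) sp] by simp
  next
    case MInf
    then show ?thesis using \<open>1 \<le> pt\<close> by simp
  qed
qed

end
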